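(* Consider the autoregressive process $(X_t)_{t\in\mathbb{Z}}$ and its bootstrap version $(X_t^* )_{t\in\mathbb{Z}}$ described in the context, and assume $\mathbb{E}\varepsilon_0^2<\infty$, $\widehat\theta_n\xrightarrow{P}\theta$ as $n\to\infty$, and that the bootstrap process is in its stationary regime. Then for every $\epsilon>0$, with $\rho_\epsilon=(1+\epsilon)/\rho$, there exist a constant $\widetilde{\widetilde K}_\epsilon<\infty$ and a sequence of events $\Omega_n$ (determined by $X_{1-p},\ldots,X_n$) with $\mathbb{P}(\Omega_n)\to1$ as $n\to\infty$ such that, if $\Omega_n$ occurs, the following holds. Let $s_1\le\cdots\le s_k\le t_1\le\cdots\le t_l$ be arbitrary integers and let $g:\mathbb{R}^k\to\mathbb{R}$ and $h:\mathbb{R}^l\to\mathbb{R}$ be measurable functions. If $g$ is bounded and $\mathbb{E}|h(X^*_{t_1},\ldots,X^*_{t_l})|<\infty$, then $$\left|\mathrm{cov}\left(g(X^*_{s_1},\ldots,X^*_{s_k}),\,h(X^*_{t_1},\ldots,X^*_{t_l})\right)\right|\le\|g\|_\infty\,\mathrm{Lip}\,h\;K_2\;l\;\rho_\epsilon^{\,t_1-s_k},$$ where $K_2=2\,\widetilde{\widetilde K}_\epsilon\sqrt{\mathbb{E}\varepsilon_0^2}$, and where the expectation and covariance of functions of the bootstrap process are taken conditionally on $X_{1-p},\ldots,X_n$.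
   Context: For $h:\mathbb{R}^l\to\mathbb{R}$, $\mathrm{Lip}\,h=\sup_{x\ne y}|h(x)-h(y)|/\|x-y\|_{l_1}\in[0,\infty]$, where $\|(z_1,\ldots,z_l)\|_{l_1}=\sum_i|z_i|$; $\|g\|_\infty=\sup_x|g(x)|$. Initial process: $(X_t)_{t\in\mathbb{Z}}$ is the stationary solution of $X_t=\theta_1X_{t-1}+\cdots+\theta_pX_{t-p}+\varepsilon_t$, $t\in\mathbb{Z}$, where $(\varepsilon_t)_{t\in\mathbb{Z}}$ are independent and identically distributed real random variables with $\mathbb{E}\varepsilon_t=0$, and the characteristic polynomial $\theta(z)=1-\theta_1z-\cdots-\theta_pz^p$ has no zero in the closed unit disc. Its roots are denoted $\xi_1,\ldots,\xi_p$, and $\rho=\min\{|\xi_1|,\ldots,|\xi_p|\}>1$. We also write $\theta=(\theta_1,\ldots,\theta_p)'$. Bootstrap process: observations $X_{1-p},\ldots,X_n$ are available and $\widehat\theta_n=(\widehat\theta_{n,1},\ldots,\widehat\theta_{n,p})'$ is an estimator of $\theta$ based on them. With $\boldsymbol{X}_t=(X_{t-1},\ldots,X_{t-p})'$, put $\widetilde\varepsilon_t=X_t-\boldsymbol{X}_t'\widehat\theta_n$ and $\widehat\varepsilon_t=\widetilde\varepsilon_t-\frac1n\sum_{s=1}^n\widetilde\varepsilon_s$, $t=1,\ldots,n$. Conditionally on $X_{1-p},\ldots,X_n$, the bootstrap innovations $(\varepsilon_t^* )_{t\in\mathbb{Z}}$ are independent draws from the empirical distribution of $\widehat\varepsilon_1,\ldots,\widehat\varepsilon_n$,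 and $(X_t^* )_{t\in\mathbb{Z}}$ satisfies $X_t^*=\widehat\theta_{n,1}X_{t-1}^*+\cdots+\widehat\theta_{n,p}X_{t-p}^*+\varepsilon_t^*$. "Stationary regime" means that $(X_t^* )$ is the stationary causal solution of this equation (such a solution exists with probability tending to one). *)

theory Defs
  imports "HOL-Probability.Probability" "HOL-Computational_Algebra.Polynomial"
begin

text \<open>The measurable space of vectors \<open>(x\<^sub>1, \<dots>, x\<^sub>k)\<close> is the product over the index set \<open>{1..k}\<close>, so
  its points are functions on \<open>{1..k}\<close> extended by \<open>undefined\<close>.\<close>

abbreviation Rn :: "nat \<Rightarrow> (nat \<Rightarrow> real) measure" where
  "Rn k \<equiv> PiM {1..k} (\<lambda>_. borel)"

definition l1_dist :: "nat \<Rightarrow> (nat \<Rightarrow> real) \<Rightarrow> (nat \<Rightarrow> real) \<Rightarrow> real" where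
  "l1_dist l x y = (\<Sum>i=1..l. \<bar>x i - y i\<bar>)"

definition Lip :: "nat \<Rightarrow> ((nat \<Rightarrow> real) \<Rightarrow> real) \<Rightarrow> ennreal" where
  "Lip l h = (SUP (x, y) \<in> {(x, y). x \<in> space (Rn l) \<and> y \<in> space (Rn l) \<and> x \<noteq> y}.
                ennreal (\<bar>h x - h y\<bar> / l1_dist l x y))"

definition sup_norm :: "nat \<Rightarrow> ((nat \<Rightarrow> real) \<Rightarrow> real) \<Rightarrow> ennreal" where
  "sup_norm k g = (SUP x \<in> space (Rn k). ennreal \<bar>g x\<bar>)"

definition covariance :: "'a measure \<Rightarrow> ('a \<Rightarrow> real) \<Rightarrow> ('a \<Rightarrow> real) \<Rightarrow> real" where
  "covariance M U V =
     integral\<^sup>L M (\<lambda>\<omega>. (U \<omega> - integral\<^sup>L M U) * (V \<omega> - integral\<^sup>L M V))"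

text \<open>Only the values \<open>\<theta> 1, \<dots>, \<theta> p\<close> of a coefficient function \<open>\<theta>\<close> are relevant.\<close>

definition ar_poly :: "nat \<Rightarrow> (nat \<Rightarrow> real) \<Rightarrow> complex poly" where
  "ar_poly p \<theta> = 1 - (\<Sum>j=1..p. monom (complex_of_real (\<theta> j)) j)"

text \<open>Meaningful only if the polynomial is not constant.\<close>

definition min_root_modulus :: "nat \<Rightarrow> (nat \<Rightarrow> real) \<Rightarrow> real" where
  "min_root_modulus p \<theta> = Min (cmod ` {\<xi>. poly (ar_poly p \<theta>) \<xi> = 0})"

definition ar_pred :: "nat \<Rightarrow> (nat \<Rightarrow> real) \<Rightarrow> (int \<Rightarrow> real) \<Rightarrow> int \<Rightarrow> real" where
  "ar_pred p \<theta> x t = (\<Sum>j=1..p. \<theta> j * x (t - int j))"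

definition iid :: "'a measure \<Rightarrow> (int \<Rightarrow> 'a \<Rightarrow> real) \<Rightarrow> bool" where
  "iid M \<epsilon> \<longleftrightarrow> prob_space.indep_vars M (\<lambda>_. borel) \<epsilon> UNIV \<and>
     (\<forall>t. distr M borel (\<epsilon> t) = distr M borel (\<epsilon> 0))"

definition ar_solution ::
  "'a measure \<Rightarrow> nat \<Rightarrow> (nat \<Rightarrow> real) \<Rightarrow> (int \<Rightarrow> 'a \<Rightarrow> real) \<Rightarrow> (int \<Rightarrow> 'a \<Rightarrow> real) \<Rightarrow> bool" where
  "ar_solution M p \<theta> \<epsilon> X \<longleftrightarrow> (\<forall>t. X t \<in> borel_measurable M) \<and>
     (\<forall>t. AE \<omega> in M. X t \<omega> = ar_pred p \<theta> (\<lambda>u. X u \<omega>) t + \<epsilon> t \<omega>)"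

text \<open>Strict stationarity: the law of the whole path is invariant under time shifts.\<close>

definition stationary :: "'a measure \<Rightarrow> (int \<Rightarrow> 'a \<Rightarrow> real) \<Rightarrow> bool" where
  "stationary M X \<longleftrightarrow>
     (\<forall>m. distr M (PiM UNIV (\<lambda>_. borel)) (\<lambda>\<omega> t. X (t + m) \<omega>) =
          distr M (PiM UNIV (\<lambda>_. borel)) (\<lambda>\<omega> t. X t \<omega>))"

text \<open>Causality: \<open>X t\<close> is an absolutely summable moving average of present and past innovations.\<close>

definition causal :: "'a measure \<Rightarrow> (int \<Rightarrow> 'a \<Rightarrow> real) \<Rightarrow> (int \<Rightarrow> 'a \<Rightarrow> real) \<Rightarrow> bool" where
  "causal M \<epsilon> X \<longleftrightarrow> (\<exists>\<psi> :: nat \<Rightarrow> real. summable (\<lambda>j. \<bar>\<psi> j\<bar>) \<and>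
     (\<forall>t. AE \<omega> in M. (\<lambda>j. \<psi> j * \<epsilon> (t - int j) \<omega>) sums X t \<omega>))"

definition stationary_causal_solution ::
  "'a measure \<Rightarrow> nat \<Rightarrow> (nat \<Rightarrow> real) \<Rightarrow> (int \<Rightarrow> 'a \<Rightarrow> real) \<Rightarrow> (int \<Rightarrow> 'a \<Rightarrow> real) \<Rightarrow> bool" where
  "stationary_causal_solution M p \<theta> \<epsilon> X \<longleftrightarrow>
     ar_solution M p \<theta> \<epsilon> X \<and> stationary M X \<and> causal M \<epsilon> X"

definition data_algebra ::
  "'a measure \<Rightarrow> (int \<Rightarrow> 'a \<Rightarrow> real) \<Rightarrow> nat \<Rightarrow> nat \<Rightarrow> 'a measure" where
  "data_algebra M X p n =
     vimage_algebra (space M) (\<lambda>\<omega>. \<lambda>t\<in>{1 - int p..int n}. X t \<omega>)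
       (PiM {1 - int p..int n} (\<lambda>_. borel))"

definition consistent ::
  "'a measure \<Rightarrow> nat \<Rightarrow> (nat \<Rightarrow> 'a \<Rightarrow> nat \<Rightarrow> real) \<Rightarrow> (nat \<Rightarrow> real) \<Rightarrow> bool" where
  "consistent M p \<theta>h \<theta> \<longleftrightarrow>
     (\<forall>\<delta>>0. (\<lambda>n. measure M {\<omega> \<in> space M. l1_dist p (\<theta>h n \<omega>) \<theta> > \<delta>}) \<longlonglongrightarrow> 0)"

definition residual :: "nat \<Rightarrow> (nat \<Rightarrow> real) \<Rightarrow> (int \<Rightarrow> real) \<Rightarrow> int \<Rightarrow> real" where
  "residual p \<theta> x t = x t - ar_pred p \<theta> x t"

definition centred_residual ::
  "nat \<Rightarrow> (nat \<Rightarrow> real) \<Rightarrow> (int \<Rightarrow> real) \<Rightarrow> nat \<Rightarrow> int \<Rightarrow> real" where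
  "centred_residual p \<theta> x n t =
     residual p \<theta> x t - (1 / real n) * (\<Sum>s=1..int n. residual p \<theta> x s)"

definition residual_distribution ::
  "nat \<Rightarrow> (nat \<Rightarrow> real) \<Rightarrow> (int \<Rightarrow> real) \<Rightarrow> nat \<Rightarrow> real measure" where
  "residual_distribution p \<theta> x n =
     distr (uniform_count_measure {1..int n}) borel (centred_residual p \<theta> x n)"

text \<open>The bootstrap world for one realisation \<open>x\<close> of the data and the value \<open>\<theta>\<close> of the estimate at
  \<open>x\<close>: \<open>N\<close> is a probability space carrying the conditional law, given the data, of the bootstrap
  innovations \<open>\<epsilon>s\<close> and of the bootstrap process \<open>Xs\<close>.\<close>

definition bootstrap_process ::
  "'b measure \<Rightarrow> nat \<Rightarrow> (nat \<Rightarrow> real) \<Rightarrow> (int \<Rightarrow> real) \<Rightarrow> nat \<Rightarrow>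
   (int \<Rightarrow> 'b \<Rightarrow> real) \<Rightarrow> (int \<Rightarrow> 'b \<Rightarrow> real) \<Rightarrow> bool" where
  "bootstrap_process N p \<theta> x n \<epsilon>s Xs \<longleftrightarrow> prob_space N \<and> iid N \<epsilon>s \<and>
     distr N borel (\<epsilon>s 0) = residual_distribution p \<theta> x n \<and> ar_solution N p \<theta> \<epsilon>s Xs"

text \<open>For unfavourable data the estimated recursion may have no stationary causal solution; this
  happens with probability tending to zero, and nothing is required of such data.\<close>

definition stationary_regime ::
  "'b measure \<Rightarrow> nat \<Rightarrow> (nat \<Rightarrow> real) \<Rightarrow> (int \<Rightarrow> 'b \<Rightarrow> real) \<Rightarrow> (int \<Rightarrow> 'b \<Rightarrow> real) \<Rightarrow> bool" where
  "stationary_regime N p \<theta> \<epsilon>s Xs \<longleftrightarrow>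
     ((\<exists>Y. stationary_causal_solution N p \<theta> \<epsilon>s Y) \<longrightarrow> stationary_causal_solution N p \<theta> \<epsilon>s Xs)"

end

theory Submission
  imports Defs "HOL-Computational_Algebra.Fundamental_Theorem_Algebra"
    "HOL-Complex_Analysis.Cauchy_Integral_Formula"
begin

text \<open>
  Let \<open>1/\<rho> < r < 1\<close>. On the disc of radius \<open>1/r\<close> the polynomial \<open>\<theta>(z)\<close> is bounded away from zero,
  and so are all polynomials with nearby coefficients; by Cauchy's inequality the coefficients
  \<open>\<psi>\<^sub>j\<close> of their reciprocals are bounded by \<open>C r\<^sup>j\<close> with a common \<open>C\<close>. Hence, as soon as the estimate is
  close to \<open>\<theta>\<close>, the bootstrap process is the moving average of its innovations with such
  weights, because a stationary solution of the recursion is unique. Removing the innovations up to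
  time \<open>s(k)\<close> from \<open>X\<^sup>*\<^bsub>t\<^esub>\<close> makes it independent of the past at the cost of a tail of this series, whose
  mean is at most a constant times \<open>r\<^bsup>t-s(k)\<^esup>\<close> times the first absolute moment of the bootstrap
  innovations. That moment is controlled by the empirical second moment of the residuals, which with
  probability tending to one is at most \<open>8 E \<epsilon>\<^sub>0\<^sup>2\<close>: a residual differs from the innovation by the
  estimation error times a vector with bounded second moment, and the squared innovations obey a weak
  law of large numbers.
\<close>

section \<open>The autoregressive recursion and its moving average weights\<close>

text \<open>One constant has to serve all \<open>n\<close> and all favourable data. A lower bound
  for a polynomial on a disc survives small changes of the coefficients without any tracking of
  individual roots, and this is what yields a common \<open>C\<close>. The process \<open>X\<close>
  is given as a stationary solution, without causality or moments. Its moving average form is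
  therefore derived, by the same uniqueness result that serves the bootstrap process; as no moments
  are available at that point, distances are measured by the mean of \<open>min 1 |.|\<close>. The
  number \<open>(1 + \<eta>) / \<rho>\<close> may exceed 1, so the rate \<open>r\<close> is
  additionally kept below 1. The bound lives in \<open>ennreal\<close>, where infinity times zero is
  zero. Hence an infinite \<open>Lip l h\<close> together with zero variance still leaves a real
  claim, and these degenerate cases get arguments of their own.\<close>

lemma poly_ar_poly:
  "poly (ar_poly p \<theta>) z = 1 - (\<Sum>j=1..p. complex_of_real (\<theta> j) * z ^ j)"
  by (simp add: ar_poly_def poly_sum poly_monom)

lemma coeff_ar_poly:
  "coeff (ar_poly p \<theta>) n = (if n = 0 then 1 else if n \<le> p then - complex_of_real (\<theta> n) else 0)"
proof -
  have "(\<Sum>j=1..p. coeff (monom (complex_of_real (\<theta> j)) j) n)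
      = (\<Sum>j=1..p. if n = j then complex_of_real (\<theta> n) else 0)"
    by (intro sum.cong) auto
  then show ?thesis
    by (auto simp: ar_poly_def coeff_sum)
qed

lemma finite_roots_ar_poly: "finite {\<xi>. poly (ar_poly p \<theta>) \<xi> = 0}"
proof (rule poly_roots_finite)
  have "coeff (ar_poly p \<theta>) 0 = 1"
    by (simp add: coeff_ar_poly)
  then show "ar_poly p \<theta> \<noteq> 0"
    by fastforce
qed

text \<open>A nonzero coefficient at an index \<open>j \<ge> 1\<close> makes the degree positive.
  Without a root, \<open>min_root_modulus\<close> would be a \<open>Min\<close> over the empty
  set.\<close>

lemma ar_poly_has_root:
  assumes "\<exists>j\<in>{1..p}. \<theta> j \<noteq> 0"
  shows "\<exists>\<xi>. poly (ar_poly p \<theta>) \<xi> = 0"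
proof -
  obtain j where "j \<in> {1..p}" "\<theta> j \<noteq> 0"
    using assms by blast
  then have "coeff (ar_poly p \<theta>) j \<noteq> 0" "j \<ge> 1"
    by (simp_all add: coeff_ar_poly)
  then have "degree (ar_poly p \<theta>) \<noteq> 0"
    using le_degree[of "ar_poly p \<theta>" j] by linarith
  then show ?thesis
    by (intro Fundamental_Theorem_Algebra.fundamental_theorem_of_algebra)
      (simp add: constant_degree)
qed

lemma ar_poly_nonzero_below_min_root:
  assumes "cmod z < min_root_modulus p \<theta>"
  shows "poly (ar_poly p \<theta>) z \<noteq> 0"
proof
  assume "poly (ar_poly p \<theta>) z = 0"
  then have "min_root_modulus p \<theta> \<le> cmod z"
    unfolding min_root_modulus_def by (intro Min_le) (auto simp: finite_roots_ar_poly)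
  then show False
    using assms by simp
qed

lemma min_root_modulus_gt_1:
  assumes "\<exists>j\<in>{1..p}. \<theta> j \<noteq> 0" "\<forall>z. cmod z \<le> 1 \<longrightarrow> poly (ar_poly p \<theta>) z \<noteq> 0"
  shows "min_root_modulus p \<theta> > 1"
proof -
  let ?Z = "cmod ` {\<xi>. poly (ar_poly p \<theta>) \<xi> = 0}"
  have "finite ?Z" "?Z \<noteq> {}"
    using finite_roots_ar_poly ar_poly_has_root[OF assms(1)] by auto
  then have "Min ?Z \<in> ?Z"
    by (rule Min_in)
  then obtain \<xi> where "poly (ar_poly p \<theta>) \<xi> = 0" "Min ?Z = cmod \<xi>"
    by blast
  then show ?thesis
    using assms(2) by (force simp: min_root_modulus_def)
qed

text \<open>The coefficients \<open>\<psi>\<^sub>n\<close> of the power series of \<open>1/\<theta>(z)\<close>; they are real, so \<open>Re\<close>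
  only changes their type.\<close>

definition ma_coeff :: "nat \<Rightarrow> (nat \<Rightarrow> real) \<Rightarrow> nat \<Rightarrow> real" where
  "ma_coeff p \<theta> n = Re (fps_nth (inverse (fps_of_poly (ar_poly p \<theta>))) n)"

section \<open>Weights of the moving average: recursion and uniform geometric decay\<close>

lemma ma_coeff_0 [simp]: "ma_coeff p \<theta> 0 = 1"
  by (simp add: ma_coeff_def coeff_ar_poly)

text \<open>Coefficient of \<open>z ^ n\<close> in the identity \<open>A * B = 1\<close> of power
  series. The guard \<open>i \<le> n\<close> stands for the convention that weights with negative
  index vanish, which truncated subtraction on \<open>nat\<close> would violate.\<close>

lemma ma_coeff_rec:
  assumes "n \<ge> 1"
  shows "ma_coeff p \<theta> n = (\<Sum>i=1..p. if i \<le> n then \<theta> i * ma_coeff p \<theta> (n - i) else 0)"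
proof -
  define A where "A = fps_of_poly (ar_poly p \<theta>)"
  define B where "B = inverse A"
  have "fps_nth A 0 = 1"
    by (simp add: A_def coeff_ar_poly)
  then have "A * B = 1"
    using inverse_mult_eq_1[of A] by (simp add: B_def mult.commute)
  then have "(\<Sum>i=0..n. fps_nth A i * fps_nth B (n - i)) = 0"
    using assms fps_mult_nth[of A B n] by simp
  then have "fps_nth A 0 * fps_nth B n + (\<Sum>i=1..n. fps_nth A i * fps_nth B (n - i)) = 0"
    by (subst (asm) sum.atLeast_Suc_atMost) auto
  then have "fps_nth B n = (\<Sum>i=1..n. - (fps_nth A i * fps_nth B (n - i)))"
    by (simp add: \<open>fps_nth A 0 = 1\<close> sum_negf eq_neg_iff_add_eq_0)
  then have "ma_coeff p \<theta> n = (\<Sum>i=1..n. - Re (fps_nth A i * fps_nth B (n - i)))"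
    by (simp add: ma_coeff_def A_def B_def)
  also have "\<dots> = (\<Sum>i=1..n. if i \<le> p then \<theta> i * ma_coeff p \<theta> (n - i) else 0)"
    by (intro sum.cong) (auto simp: ma_coeff_def A_def B_def coeff_ar_poly)
  also have "\<dots> = (\<Sum>i\<in>{1..n} \<inter> {1..p}. \<theta> i * ma_coeff p \<theta> (n - i))"
    by (intro sum.mono_neutral_cong_right) auto
  also have "\<dots> = (\<Sum>i=1..p. if i \<le> n then \<theta> i * ma_coeff p \<theta> (n - i) else 0)"
    by (intro sum.mono_neutral_cong_left) auto
  finally show ?thesis .
qed

lemma norm_ma_coeff_le:
  assumes "R > 0" "b > 0" "\<And>z. cmod z \<le> R \<Longrightarrow> b \<le> cmod (poly (ar_poly p \<theta>) z)"
  shows "\<bar>ma_coeff p \<theta> n\<bar> \<le> (1 / b) / R ^ n"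
proof -
  define A where "A = fps_of_poly (ar_poly p \<theta>)"
  define f where "f = (\<lambda>z. inverse (poly (ar_poly p \<theta>) z))"
  have nz: "poly (ar_poly p \<theta>) z \<noteq> 0" if "cmod z \<le> R" for z
    using assms(3)[OF that] assms(2) by auto
  have "poly (ar_poly p \<theta>) has_fps_expansion A"
    by (auto simp: has_fps_expansion_def A_def)
  moreover have "fps_nth A 0 \<noteq> 0"
    by (simp add: A_def coeff_ar_poly)
  ultimately have "f has_fps_expansion inverse A"
    unfolding f_def by (rule has_fps_expansion_inverse)
  then have "fps_nth (inverse A) n = (deriv ^^ n) f 0 / fact n"
    by (rule fps_nth_fps_expansion)
  moreover have "cmod ((deriv ^^ n) f 0) \<le> fact n * (1 / b) / R ^ n"
  proof (rule Cauchy_inequality)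
    show "f holomorphic_on ball 0 R" "continuous_on (cball 0 R) f"
      unfolding f_def using nz by (auto intro!: holomorphic_intros continuous_intros)
    fix z :: complex
    assume "cmod (0 - z) = R"
    then have "b \<le> cmod (poly (ar_poly p \<theta>) z)"
      by (intro assms(3)) simp
    then show "cmod (f z) \<le> 1 / b"
      using \<open>b > 0\<close> by (simp add: f_def norm_inverse divide_inverse le_imp_inverse_le)
  qed fact
  ultimately have "cmod (fps_nth (inverse A) n) \<le> fact n * (1 / b) / R ^ n / fact n"
    by (simp only: norm_divide norm_fact divide_right_mono fact_ge_zero)
  then have "cmod (fps_nth (inverse A) n) \<le> (1 / b) / R ^ n"
    by simp
  then show ?thesis
    using abs_Re_le_cmod[of "fps_nth (inverse A) n"] by (simp add: ma_coeff_def A_def)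
qed

lemma ma_coeff_geometric_bound_near:
  assumes "R > 0" "\<forall>z. cmod z \<le> R \<longrightarrow> poly (ar_poly p \<theta>) z \<noteq> 0"
  obtains C \<delta> where "C > 0" "\<delta> > 0"
    "\<And>\<theta>' n. l1_dist p \<theta>' \<theta> \<le> \<delta> \<Longrightarrow> \<bar>ma_coeff p \<theta>' n\<bar> \<le> C * (1 / R) ^ n"
proof -
  have "\<exists>z0\<in>cball 0 R. \<forall>z\<in>cball 0 R. cmod (poly (ar_poly p \<theta>) z0) \<le> cmod (poly (ar_poly p \<theta>) z)"
    using \<open>R > 0\<close> by (intro continuous_attains_inf) (auto intro!: continuous_intros)
  then obtain z0 where z0: "cmod z0 \<le> R"
      "\<And>z. cmod z \<le> R \<Longrightarrow> cmod (poly (ar_poly p \<theta>) z0) \<le> cmod (poly (ar_poly p \<theta>) z)"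
    by auto
  define c where "c = cmod (poly (ar_poly p \<theta>) z0)"
  \<comment> \<open>\<open>S\<close> dominates \<open>|z| ^ j\<close> for
    \<open>1 \<le> j \<le> p\<close> on the disc, also when \<open>R < 1\<close>. A perturbation of
    size \<open>\<delta>\<close> then changes the polynomial by at most
    \<open>\<delta> * S = c / 2\<close>, half of its minimum \<open>c\<close>.\<close>
  define S where "S = (max 1 R) ^ p"
  define \<delta> where "\<delta> = c / 2 / S"
  have "c > 0"
    using z0(1) assms(2) by (simp add: c_def)
  have "S > 0"
    by (simp add: S_def)
  have lower: "c / 2 \<le> cmod (poly (ar_poly p \<theta>') z)"
    if "l1_dist p \<theta>' \<theta> \<le> \<delta>" "cmod z \<le> R" for \<theta>' z
  proof -
    have "poly (ar_poly p \<theta>) z - poly (ar_poly p \<theta>') z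
        = (\<Sum>j=1..p. complex_of_real (\<theta>' j - \<theta> j) * z ^ j)"
      by (simp add: poly_ar_poly sum_subtractf[symmetric] algebra_simps)
    then have "cmod (poly (ar_poly p \<theta>) z - poly (ar_poly p \<theta>') z)
        \<le> (\<Sum>j=1..p. \<bar>\<theta>' j - \<theta> j\<bar> * cmod z ^ j)"
      by (metis (no_types, lifting) sum_norm_le norm_mult norm_of_real norm_power order_refl)
    also have "\<dots> \<le> (\<Sum>j=1..p. \<bar>\<theta>' j - \<theta> j\<bar> * S)"
    proof (intro sum_mono mult_left_mono)
      fix j assume "j \<in> {1..p}"
      have "cmod z ^ j \<le> max 1 R ^ j"
        using that(2) by (intro power_mono) auto
      also have "\<dots> \<le> S"
        unfolding S_def using \<open>j \<in> {1..p}\<close> by (intro power_increasing) auto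
      finally show "cmod z ^ j \<le> S" .
    qed auto
    also have "\<dots> = l1_dist p \<theta>' \<theta> * S"
      by (simp add: l1_dist_def sum_distrib_right)
    also have "\<dots> \<le> c / 2"
      using that(1) \<open>S > 0\<close> by (simp add: \<delta>_def field_simps)
    finally have "cmod (poly (ar_poly p \<theta>) z - poly (ar_poly p \<theta>') z) \<le> c / 2" .
    moreover have "c \<le> cmod (poly (ar_poly p \<theta>) z)"
      using z0(2) that(2) by (simp add: c_def)
    ultimately show ?thesis
      using norm_triangle_ineq2[of "poly (ar_poly p \<theta>) z" "poly (ar_poly p \<theta>') z"] by linarith
  qed
  show thesis
  proof (rule that)
    show "1 / (c / 2) > 0" "\<delta> > 0"
      using \<open>c > 0\<close> \<open>S > 0\<close> by (simp_all add: \<delta>_def)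
    fix \<theta>' n
    assume "l1_dist p \<theta>' \<theta> \<le> \<delta>"
    then show "\<bar>ma_coeff p \<theta>' n\<bar> \<le> 1 / (c / 2) * (1 / R) ^ n"
      using norm_ma_coeff_le[of R "c / 2" p \<theta>' n] lower \<open>R > 0\<close> \<open>c > 0\<close>
      by (simp add: power_one_over)
  qed
qed

section \<open>Iterating the recursion along a path\<close>

text \<open>The recursion is multiplied by the series of \<open>1/\<theta>(z)\<close> truncated at
  degree \<open>m\<close>. The product of this truncation with \<open>\<theta>(z)\<close> is 1 up to
  terms of degree \<open>m + 1, ..., m + p\<close>; these are the pairs with
  \<open>j \<le> m < i + j\<close> in the second sum. The lower limit \<open>Suc m - i\<close> is 0
  when \<open>i > m\<close>, and then all \<open>j \<le> m\<close> occur.\<close>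

lemma ar_iterate:
  assumes "\<And>u. x u = ar_pred p \<theta> x u + e u"
  shows "x t = (\<Sum>j<Suc m. ma_coeff p \<theta> j * e (t - int j))
    + (\<Sum>i=1..p. \<Sum>j=Suc m-i..<Suc m. \<theta> i * ma_coeff p \<theta> j * x (t - int j - int i))"
proof (induction m)
  case 0
  have "(\<Sum>i=1..p. \<Sum>j=Suc 0-i..<Suc 0. \<theta> i * ma_coeff p \<theta> j * x (t - int j - int i))
      = ar_pred p \<theta> x t"
    unfolding ar_pred_def by (intro sum.cong) auto
  then show ?case
    using assms[of t] by simp
next
  case (Suc m)
  let ?\<psi> = "ma_coeff p \<theta>"
  let ?R = "\<lambda>m i. \<Sum>j=m-i..<m. \<theta> i * ?\<psi> j * x (t - int j - int i)"
  let ?n = "Suc m"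
  \<comment> \<open>For a fixed lag \<open>i\<close> the index \<open>?n\<close> enters and the
    index \<open>?n - i\<close>, if it exists, leaves. All leaving terms contain the same value
    \<open>x (t - int ?n)\<close>, and their coefficients add up to \<open>?\<psi> ?n\<close> by
    \<open>ma_coeff_rec\<close>.\<close>
  have step: "?R (Suc ?n) i = ?R ?n i + ?\<psi> ?n * (\<theta> i * x (t - int ?n - int i))
      - x (t - int ?n) * (if i \<le> ?n then \<theta> i * ?\<psi> (?n - i) else 0)" if "i \<in> {1..p}" for i
  proof (cases "i \<le> ?n")
    case True
    then have "{Suc ?n - i..<Suc ?n} = insert ?n ({?n - i..<?n} - {?n - i})" "?n - i \<in> {?n - i..<?n}"
      using that by auto
    then have "?R (Suc ?n) i = \<theta> i * ?\<psi> ?n * x (t - int ?n - int i)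
        + (?R ?n i - \<theta> i * ?\<psi> (?n - i) * x (t - int (?n - i) - int i))"
      by (simp add: sum_diff1)
    moreover have "t - int (?n - i) - int i = t - int ?n"
      using True by simp
    ultimately show ?thesis
      using True by (simp add: algebra_simps)
  next
    case False
    then have "Suc ?n - i = 0" "?n - i = 0"
      by auto
    then show ?thesis
      using False by (simp add: algebra_simps)
  qed
  have "(\<Sum>i=1..p. ?R (Suc ?n) i) = (\<Sum>i=1..p. ?R ?n i) + ?\<psi> ?n * ar_pred p \<theta> x (t - int ?n)
      - x (t - int ?n) * (\<Sum>i=1..p. if i \<le> ?n then \<theta> i * ?\<psi> (?n - i) else 0)"
    unfolding ar_pred_def sum_distrib_left
    by (simp only: sum.distrib[symmetric] sum_subtractf[symmetric]) (intro sum.cong step; simp)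
  also have "(\<Sum>i=1..p. if i \<le> ?n then \<theta> i * ?\<psi> (?n - i) else 0) = ?\<psi> ?n"
    by (rule ma_coeff_rec[symmetric]) simp
  also have "ar_pred p \<theta> x (t - int ?n) = x (t - int ?n) - e (t - int ?n)"
    using assms[of "t - int ?n"] by simp
  finally have "(\<Sum>i=1..p. ?R (Suc ?n) i) = (\<Sum>i=1..p. ?R ?n i) - ?\<psi> ?n * e (t - int ?n)"
    by (simp add: algebra_simps)
  then show ?case
    using Suc.IH by simp
qed

text \<open>Without noise only the remainder of \<open>ar_iterate\<close> is left. Its weights have
  index at least \<open>m + 1 - p\<close>, hence the division by \<open>r ^ p\<close>, and its
  arguments \<open>t - j - i\<close> lie in a window of \<open>p\<close> consecutive times, whatever
  \<open>m\<close> is.\<close>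

lemma ar_homogeneous_bound:
  assumes "\<And>u. d u = ar_pred p \<theta> d u" "\<And>j. \<bar>ma_coeff p \<theta> j\<bar> \<le> C * r ^ j" "0 < r" "r \<le> 1"
  shows "\<bar>d t\<bar> \<le> C / r ^ p * (\<Sum>i=1..p. \<bar>\<theta> i\<bar>) * r ^ Suc m * (\<Sum>u<p. \<bar>d (t - int (Suc m) - int u)\<bar>)"
proof -
  define W where "W = (\<Sum>u<p. \<bar>d (t - int (Suc m) - int u)\<bar>)"
  define B where "B = C / r ^ p * r ^ Suc m"
  have "C \<ge> 0"
    using assms(2)[of 0] by simp
  then have "B \<ge> 0"
    using assms by (simp add: B_def)
  have psi: "\<bar>ma_coeff p \<theta> j\<bar> \<le> B" if "Suc m \<le> j + p" for j
  proof -
    have "r ^ (j + p) \<le> r ^ Suc m"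
      using that assms by (intro power_decreasing) auto
    then have "r ^ j \<le> r ^ Suc m / r ^ p"
      using \<open>0 < r\<close> by (simp add: power_add field_simps)
    then have "C * r ^ j \<le> C * (r ^ Suc m / r ^ p)"
      using \<open>C \<ge> 0\<close> by (rule mult_left_mono)
    then show ?thesis
      using assms(2)[of j] by (simp add: B_def)
  qed
  have inner: "(\<Sum>j=Suc m-i..<Suc m. \<bar>d (t - int j - int i)\<bar>) \<le> W" if "i \<in> {1..p}" for i
    unfolding W_def
  \<comment> \<open>For a fixed \<open>i\<close> the map from \<open>j\<close> to the position
    \<open>u = j + i - Suc m\<close> in the window is injective, and the given function is its
    inverse. From \<open>j \<le> m\<close> and \<open>i \<le> p\<close> follows
    \<open>u < p\<close>.\<close>
  proof (rule sum_le_included[where i = "\<lambda>u. Suc m + u - i"])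
    show "\<forall>j\<in>{Suc m - i..<Suc m}. \<exists>u\<in>{..<p}. Suc m + u - i = j
        \<and> \<bar>d (t - int j - int i)\<bar> \<le> \<bar>d (t - int (Suc m) - int u)\<bar>"
    proof
      fix j assume j: "j \<in> {Suc m - i..<Suc m}"
      show "\<exists>u\<in>{..<p}. Suc m + u - i = j
        \<and> \<bar>d (t - int j - int i)\<bar> \<le> \<bar>d (t - int (Suc m) - int u)\<bar>"
      proof (intro bexI conjI)
        have "t - int j - int i = t - int (Suc m) - int (j + i - Suc m)"
          using j by auto
        then show "\<bar>d (t - int j - int i)\<bar> \<le> \<bar>d (t - int (Suc m) - int (j + i - Suc m))\<bar>"
          by (simp only: order_refl)
      qed (use j that in auto)
    qed
  qed auto
  have "d t = (\<Sum>i=1..p. \<Sum>j=Suc m-i..<Suc m. \<theta> i * ma_coeff p \<theta> j * d (t - int j - int i))"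
    using ar_iterate[of d p \<theta> "\<lambda>_. 0" t m] assms(1) by simp
  also have "\<bar>\<dots>\<bar> \<le> (\<Sum>i=1..p. \<Sum>j=Suc m-i..<Suc m. \<bar>\<theta> i * ma_coeff p \<theta> j * d (t - int j - int i)\<bar>)"
    by (intro order_trans[OF sum_abs] sum_mono sum_abs)
  also have "\<dots> \<le> (\<Sum>i=1..p. \<Sum>j=Suc m-i..<Suc m. \<bar>\<theta> i\<bar> * B * \<bar>d (t - int j - int i)\<bar>)"
    using psi by (intro sum_mono) (auto simp: abs_mult intro!: mult_right_mono mult_left_mono)
  also have "\<dots> = (\<Sum>i=1..p. \<bar>\<theta> i\<bar> * B * (\<Sum>j=Suc m-i..<Suc m. \<bar>d (t - int j - int i)\<bar>))"
    by (simp only: sum_distrib_left)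
  also have "\<dots> \<le> (\<Sum>i=1..p. \<bar>\<theta> i\<bar> * B * W)"
    using \<open>B \<ge> 0\<close> inner by (intro sum_mono mult_left_mono) auto
  also have "\<dots> = C / r ^ p * (\<Sum>i=1..p. \<bar>\<theta> i\<bar>) * r ^ Suc m * W"
    by (simp only: B_def sum_distrib_right[symmetric]) simp
  finally show ?thesis
    by (simp add: W_def)
qed

text \<open>A pathwise identity: the shifted series, one for each lag \<open>i\<close>, are added
  and regrouped by the total lag \<open>n = i + j\<close>. Only finitely many series are combined,
  so no double series is rearranged and plain convergence suffices.\<close>

lemma ma_series_solves_ar:
  assumes "\<And>t. summable (\<lambda>j. ma_coeff p \<theta> j * e (t - int j))"
  defines "y \<equiv> \<lambda>t. \<Sum>j. ma_coeff p \<theta> j * e (t - int j)"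
  shows "y t = ar_pred p \<theta> y t + e t"
proof -
  let ?\<psi> = "ma_coeff p \<theta>"
  let ?c = "\<lambda>i n. if i \<le> n then \<theta> i * ?\<psi> (n - i) else 0"
  have "(\<lambda>n. ?c i n * e (t - int n)) sums (\<theta> i * y (t - int i))" for i
  proof -
    have "(\<lambda>j. \<theta> i * (?\<psi> j * e (t - int i - int j))) sums (\<theta> i * y (t - int i))"
      unfolding y_def by (intro sums_mult summable_sums assms)
    then have "(\<lambda>j. ?c i (j + i) * e (t - int (j + i))) sums (\<theta> i * y (t - int i))"
      by (simp add: algebra_simps)
    then show ?thesis
      by (subst (asm) sums_zero_iff_shift) auto
  qed
  then have "(\<lambda>n. \<Sum>i=1..p. ?c i n * e (t - int n)) sums (\<Sum>i=1..p. \<theta> i * y (t - int i))"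
    by (intro sums_sum)
  then have "(\<lambda>n. (\<Sum>i=1..p. ?c i n) * e (t - int n)) sums ar_pred p \<theta> y t"
    by (simp only: ar_pred_def sum_distrib_right)
  \<comment> \<open>\<open>ma_coeff_rec\<close> starts at \<open>n = 1\<close>. At
    \<open>n = 0\<close> the convolution vanishes, and this extra term supplies \<open>e t\<close>,
    in accordance with the leading weight 1.\<close>
  moreover have "(\<lambda>n. if n = 0 then e t else 0) sums e t"
    using sums_single[of 0 "\<lambda>_. e t"] by simp
  ultimately have "(\<lambda>n. (\<Sum>i=1..p. ?c i n) * e (t - int n) + (if n = 0 then e t else 0))
      sums (ar_pred p \<theta> y t + e t)"
    by (rule sums_add)
  also have "(\<lambda>n. (\<Sum>i=1..p. ?c i n) * e (t - int n) + (if n = 0 then e t else 0))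
      = (\<lambda>n. ?\<psi> n * e (t - int n))"
  proof
    fix n
    show "(\<Sum>i=1..p. ?c i n) * e (t - int n) + (if n = 0 then e t else 0) = ?\<psi> n * e (t - int n)"
      using ma_coeff_rec[of n p \<theta>] by (cases "n = 0") auto
  qed
  finally show ?thesis
    by (simp add: y_def sums_iff)
qed

section \<open>Stationary solutions driven by iid innovations\<close>

lemma summable_abs_of_geometric_bound:
  fixes \<psi> :: "nat \<Rightarrow> real"
  assumes "\<And>j. \<bar>\<psi> j\<bar> \<le> C * r ^ j" "0 < r" "r < 1"
  shows "summable (\<lambda>j. \<bar>\<psi> j\<bar>)"
proof (rule summable_comparison_test)
  show "\<exists>N. \<forall>j\<ge>N. norm \<bar>\<psi> j\<bar> \<le> C * r ^ j"
    using assms(1) by simp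
  show "summable (\<lambda>j. C * r ^ j)"
    using assms by (intro summable_mult summable_geometric) simp
qed

lemma measurable_path:
  assumes "\<And>t. f t \<in> borel_measurable M"
  shows "(\<lambda>\<omega> t. f t \<omega>) \<in> M \<rightarrow>\<^sub>M (PiM UNIV (\<lambda>_. borel))"
  using assms by (intro measurable_PiM_single') auto

lemma stationary_distr:
  assumes "stationary M X" "\<And>t. X t \<in> borel_measurable M"
  shows "distr M borel (X t) = distr M borel (X 0)"
proof -
  let ?P = "PiM UNIV (\<lambda>_. borel) :: (int \<Rightarrow> real) measure"
  have proj: "(\<lambda>f. f 0) \<in> ?P \<rightarrow>\<^sub>M borel"
    by simp
  have path: "(\<lambda>\<omega> s. X (s + m) \<omega>) \<in> M \<rightarrow>\<^sub>M ?P" for m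
    by (intro measurable_path assms)
  have "distr M borel (X m) = distr (distr M ?P (\<lambda>\<omega> s. X (s + m) \<omega>)) borel (\<lambda>f. f 0)" for m
    by (subst distr_distr[OF proj path]) (simp add: comp_def)
  moreover have "distr M ?P (\<lambda>\<omega> s. X (s + t) \<omega>) = distr M ?P (\<lambda>\<omega> s. X (s + 0) \<omega>)"
    using assms(1) unfolding stationary_def by simp
  ultimately show ?thesis
    by metis
qed

lemma nn_integral_distr_eq:
  assumes "distr M borel X = distr M borel Y" "X \<in> borel_measurable M" "Y \<in> borel_measurable M"
    "f \<in> borel_measurable borel"
  shows "(\<integral>\<^sup>+\<omega>. f (X \<omega>) \<partial>M) = (\<integral>\<^sup>+\<omega>. f (Y \<omega>) \<partial>M)"
  using assms nn_integral_distr[of X M borel f] nn_integral_distr[of Y M borel f] by simp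

lemma integral_distr_eq:
  fixes f :: "real \<Rightarrow> real"
  assumes "distr M borel X = distr M borel Y" "X \<in> borel_measurable M" "Y \<in> borel_measurable M"
    "f \<in> borel_measurable borel"
  shows "(\<integral>\<omega>. f (X \<omega>) \<partial>M) = (\<integral>\<omega>. f (Y \<omega>) \<partial>M)"
  using assms integral_distr[of X M borel f] integral_distr[of Y M borel f] by simp

lemma integrable_distr_eq_iff:
  fixes f :: "real \<Rightarrow> real"
  assumes "distr M borel X = distr M borel Y" "X \<in> borel_measurable M" "Y \<in> borel_measurable M"
    "f \<in> borel_measurable borel"
  shows "integrable M (\<lambda>\<omega>. f (X \<omega>)) \<longleftrightarrow> integrable M (\<lambda>\<omega>. f (Y \<omega>))"
  using assms integrable_distr_eq[of X M borel f] integrable_distr_eq[of Y M borel f] by simp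

text \<open>Truncation at 1 makes everything integrable without any moment assumption; subadditivity
  lets it act on each term of a finite window separately.\<close>

lemma min_1_sum_le:
  fixes f :: "'i \<Rightarrow> real"
  assumes "\<And>i. i \<in> A \<Longrightarrow> 0 \<le> f i"
  shows "min 1 (\<Sum>i\<in>A. f i) \<le> (\<Sum>i\<in>A. min 1 (f i))"
  using assms
proof (induction A rule: infinite_finite_induct)
  case (insert x F)
  then have "0 \<le> f x" "0 \<le> (\<Sum>i\<in>F. f i)"
    by (auto intro: sum_nonneg)
  then have "min 1 (f x + (\<Sum>i\<in>F. f i)) \<le> min 1 (f x) + min 1 (\<Sum>i\<in>F. f i)"
    by linarith
  moreover have "min 1 (\<Sum>i\<in>F. f i) \<le> (\<Sum>i\<in>F. min 1 (f i))"
    using insert by simp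
  ultimately show ?case
    using insert(1,2) by simp
qed auto

lemma (in prob_space) expectation_min_1_scaled_tendsto_0:
  fixes X :: "'a \<Rightarrow> real"
  assumes [measurable]: "X \<in> borel_measurable M" and "c \<longlonglongrightarrow> 0"
  shows "(\<lambda>m. expectation (\<lambda>\<omega>. min 1 (\<bar>c m * X \<omega>\<bar>))) \<longlonglongrightarrow> 0"
proof -
  have "(\<lambda>m. expectation (\<lambda>\<omega>. min 1 (\<bar>c m * X \<omega>\<bar>))) \<longlonglongrightarrow> expectation (\<lambda>\<omega>. 0)"
  proof (rule integral_dominated_convergence[where w = "\<lambda>_. 1"])
    show "AE \<omega> in M. (\<lambda>m. min 1 \<bar>c m * X \<omega>\<bar>) \<longlonglongrightarrow> 0"
    proof (rule AE_I2)
      fix \<omega>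
      have "(\<lambda>m. min 1 \<bar>c m * X \<omega>\<bar>) \<longlonglongrightarrow> min 1 \<bar>0 * X \<omega>\<bar>"
        by (intro tendsto_intros assms)
      then show "(\<lambda>m. min 1 \<bar>c m * X \<omega>\<bar>) \<longlonglongrightarrow> 0"
        by simp
    qed
  qed auto
  then show ?thesis
    by simp
qed

text \<open>The difference \<open>D\<close> of two stationary solutions satisfies the homogeneous recursion. Running it
  backwards expresses \<open>D\<^sub>t\<close> through \<open>D\<^bsub>t-m\<^esub>, \<dots>\<close> with coefficients that vanish as \<open>m\<close> grows,
  while the laws of \<open>X\<^bsub>t-m\<^esub>\<close> and \<open>Z\<^bsub>t-m\<^esub>\<close> do not depend on \<open>m\<close>.\<close>

lemma (in prob_space) stationary_ar_solution_unique:
  assumes X: "ar_solution M p \<theta> \<epsilon> X" "stationary M X"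
    and Z: "ar_solution M p \<theta> \<epsilon> Z" "stationary M Z"
    and psi: "\<And>j. \<bar>ma_coeff p \<theta> j\<bar> \<le> C * r ^ j" "0 < r" "r < 1"
  shows "AE \<omega> in M. X t \<omega> = Z t \<omega>"
proof -
  have [measurable]: "X t \<in> borel_measurable M" "Z t \<in> borel_measurable M" for t
    using X(1) Z(1) by (auto simp: ar_solution_def)
  define D where "D = (\<lambda>t \<omega>. X t \<omega> - Z t \<omega>)"
  define c where "c = (\<lambda>m. C / r ^ p * (\<Sum>i=1..p. \<bar>\<theta> i\<bar>) * r ^ Suc m)"
  \<comment> \<open>By stationarity of \<open>V\<close> the value at time 0 is the value at every
    time; only the factor \<open>c m\<close> depends on \<open>m\<close>.\<close>
  define a where "a = (\<lambda>V :: int \<Rightarrow> 'a \<Rightarrow> real. \<lambda>m. expectation (\<lambda>\<omega>. min 1 \<bar>c m * V 0 \<omega>\<bar>))"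
  have "c \<longlonglongrightarrow> C / r ^ p * (\<Sum>i=1..p. \<bar>\<theta> i\<bar>) * 0"
    unfolding c_def using psi by (intro tendsto_intros LIMSEQ_Suc LIMSEQ_realpow_zero) auto
  then have c: "c \<longlonglongrightarrow> 0"
    by simp
  have "C \<ge> 0"
    using psi(1)[of 0] by simp
  then have "c m \<ge> 0" for m
    using psi by (simp add: c_def sum_nonneg)
  have int: "integrable M (\<lambda>\<omega>. min 1 \<bar>f \<omega>\<bar>)" if [measurable]: "f \<in> borel_measurable M" for f :: "'a \<Rightarrow> real"
    by (intro integrable_const_bound[where B = 1]) auto
  have shift: "expectation (\<lambda>\<omega>. min 1 \<bar>c m * V t \<omega>\<bar>) = a V m"
    if "stationary M V" "\<And>t. V t \<in> borel_measurable M" for V t m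
    unfolding a_def using stationary_distr[OF that] that
    by (intro integral_distr_eq[where f = "\<lambda>x. min 1 \<bar>c m * x\<bar>"]) auto
  have le: "expectation (\<lambda>\<omega>. min 1 \<bar>D t \<omega>\<bar>) \<le> real p * (a X m + a Z m)" for m
  proof -
    have rec: "AE \<omega> in M. \<forall>u. D u \<omega> = ar_pred p \<theta> (\<lambda>u. D u \<omega>) u"
    proof (subst AE_all_countable, intro allI)
      fix u
      have "AE \<omega> in M. X u \<omega> = ar_pred p \<theta> (\<lambda>u. X u \<omega>) u + \<epsilon> u \<omega>"
        "AE \<omega> in M. Z u \<omega> = ar_pred p \<theta> (\<lambda>u. Z u \<omega>) u + \<epsilon> u \<omega>"
        using X(1) Z(1) by (auto simp: ar_solution_def)
      then show "AE \<omega> in M. D u \<omega> = ar_pred p \<theta> (\<lambda>u. D u \<omega>) u"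
        by eventually_elim
          (simp add: D_def ar_pred_def sum_subtractf[symmetric] right_diff_distrib)
    qed
    have bound: "min 1 \<bar>D t \<omega>\<bar>
        \<le> (\<Sum>u<p. min 1 \<bar>c m * X (t - int (Suc m) - int u) \<omega>\<bar>
            + min 1 \<bar>c m * Z (t - int (Suc m) - int u) \<omega>\<bar>)"
      if elim: "\<forall>u. D u \<omega> = ar_pred p \<theta> (\<lambda>u. D u \<omega>) u" for \<omega>
    proof -
      let ?v = "\<lambda>u. t - int (Suc m) - int u"
      have "\<bar>D t \<omega>\<bar> \<le> c m * (\<Sum>u<p. \<bar>D (?v u) \<omega>\<bar>)"
        unfolding c_def
        by (rule ar_homogeneous_bound[where d = "\<lambda>u. D u \<omega>",
              OF elim[rule_format] psi(1,2) less_imp_le[OF psi(3)]])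
      also have "\<dots> = (\<Sum>u<p. \<bar>c m * D (?v u) \<omega>\<bar>)"
        using \<open>c m \<ge> 0\<close> by (simp add: sum_distrib_left abs_mult)
      finally have "min 1 \<bar>D t \<omega>\<bar> \<le> min 1 (\<Sum>u<p. \<bar>c m * D (?v u) \<omega>\<bar>)"
        by auto
      also have "\<dots> \<le> (\<Sum>u<p. min 1 \<bar>c m * D (?v u) \<omega>\<bar>)"
        by (intro min_1_sum_le) auto
      \<comment> \<open>\<open>X\<close> and \<open>Z\<close> are stationary separately, not
        jointly, so the law of their difference might vary with time. Splitting \<open>D\<close>
        reduces the bound to marginal laws, which do not.\<close>
      also have "\<dots> \<le> (\<Sum>u<p. min 1 \<bar>c m * X (?v u) \<omega>\<bar> + min 1 \<bar>c m * Z (?v u) \<omega>\<bar>)"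
      proof (intro sum_mono)
        fix u
        have "c m * D (?v u) \<omega> = c m * X (?v u) \<omega> - c m * Z (?v u) \<omega>"
          by (simp add: D_def right_diff_distrib)
        then show "min 1 \<bar>c m * D (?v u) \<omega>\<bar>
            \<le> min 1 \<bar>c m * X (?v u) \<omega>\<bar> + min 1 \<bar>c m * Z (?v u) \<omega>\<bar>"
          by (auto simp: min_def)
      qed
      finally show ?thesis .
    qed
    have "expectation (\<lambda>\<omega>. min 1 \<bar>D t \<omega>\<bar>)
      \<le> expectation (\<lambda>\<omega>. \<Sum>u<p. min 1 \<bar>c m * X (t - int (Suc m) - int u) \<omega>\<bar>
            + min 1 \<bar>c m * Z (t - int (Suc m) - int u) \<omega>\<bar>)"
    proof (rule integral_mono_AE)
      show "AE \<omega> in M. min 1 \<bar>D t \<omega>\<bar>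
        \<le> (\<Sum>u<p. min 1 \<bar>c m * X (t - int (Suc m) - int u) \<omega>\<bar>
            + min 1 \<bar>c m * Z (t - int (Suc m) - int u) \<omega>\<bar>)"
        using rec by (rule eventually_mono) (rule bound)
    qed (auto intro!: int Bochner_Integration.integrable_sum Bochner_Integration.integrable_add simp: D_def)
    also have "\<dots> = (\<Sum>u<p. a X m + a Z m)"
      by (subst Bochner_Integration.integral_sum)
        (auto intro!: int Bochner_Integration.integrable_add sum.cong
          simp: Bochner_Integration.integral_add[OF int int] shift X Z)
    finally show ?thesis
      by simp
  qed
  have "(\<lambda>m. real p * (a X m + a Z m)) \<longlonglongrightarrow> real p * (0 + 0)"
    unfolding a_def by (intro tendsto_intros expectation_min_1_scaled_tendsto_0 c) auto
  then have "expectation (\<lambda>\<omega>. min 1 \<bar>D t \<omega>\<bar>) \<le> 0"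
    using le by (intro LIMSEQ_le_const) auto
  moreover have "expectation (\<lambda>\<omega>. min 1 \<bar>D t \<omega>\<bar>) \<ge> 0"
    by (intro integral_nonneg_AE) auto
  ultimately have "expectation (\<lambda>\<omega>. min 1 \<bar>D t \<omega>\<bar>) = 0"
    by simp
  then have "AE \<omega> in M. min 1 \<bar>D t \<omega>\<bar> = 0"
    by (subst (asm) integral_nonneg_eq_0_iff_AE) (auto intro!: int simp: D_def)
  then show ?thesis
    by eventually_elim (auto simp: D_def min_def split: if_splits)
qed

section \<open>Linear processes in iid innovations\<close>

text \<open>Used for the innovations, for their squares, and for the bootstrap innovations with the
  data fixed. The squares have only a first moment, so second moments enter as separate hypotheses
  of individual lemmas.\<close>

locale iid_sequence = prob_space M for M :: "'a measure" +
  fixes \<epsilon> :: "int \<Rightarrow> 'a \<Rightarrow> real"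
  assumes iid: "iid M \<epsilon>"
    and integrable_0: "integrable M (\<epsilon> 0)"
begin

lemma indep: "indep_vars (\<lambda>_. borel) \<epsilon> UNIV"
  using iid by (simp add: iid_def)

lemma measurable_noise [measurable]: "\<epsilon> t \<in> borel_measurable M"
  using indep by (simp add: indep_vars_def)

lemma distr_noise: "distr M borel (\<epsilon> t) = distr M borel (\<epsilon> 0)"
  using iid by (simp add: iid_def)

lemma iid_comp:
  assumes [measurable]: "f \<in> borel_measurable borel"
  shows "iid M (\<lambda>t \<omega>. f (\<epsilon> t \<omega>))"
  unfolding iid_def
proof (intro conjI allI)
  show "indep_vars (\<lambda>_. borel) (\<lambda>t \<omega>. f (\<epsilon> t \<omega>)) UNIV"
    by (rule indep_vars_compose2[OF indep]) auto
  fix t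
  have "distr M borel (\<lambda>\<omega>. f (\<epsilon> t \<omega>)) = distr (distr M borel (\<epsilon> t)) borel f" for t
    by (subst distr_distr) (auto simp: comp_def)
  then show "distr M borel (\<lambda>\<omega>. f (\<epsilon> t \<omega>)) = distr M borel (\<lambda>\<omega>. f (\<epsilon> 0 \<omega>))"
    using distr_noise[of t] by simp
qed

lemma nn_integral_abs_noise: "(\<integral>\<^sup>+\<omega>. ennreal \<bar>\<epsilon> t \<omega>\<bar> \<partial>M) = ennreal (expectation (\<lambda>\<omega>. \<bar>\<epsilon> 0 \<omega>\<bar>))"
proof -
  have "(\<integral>\<^sup>+\<omega>. ennreal \<bar>\<epsilon> t \<omega>\<bar> \<partial>M) = (\<integral>\<^sup>+\<omega>. ennreal \<bar>\<epsilon> 0 \<omega>\<bar> \<partial>M)"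
    by (rule nn_integral_distr_eq[OF distr_noise, where f = "\<lambda>x. ennreal \<bar>x\<bar>"]) auto
  also have "\<dots> = ennreal (expectation (\<lambda>\<omega>. \<bar>\<epsilon> 0 \<omega>\<bar>))"
    using integrable_0 by (intro nn_integral_eq_integral) auto
  finally show ?thesis .
qed

lemma nn_integral_abs_noise_series:
  assumes "summable (\<lambda>j. \<bar>\<psi> j\<bar>)"
  shows "(\<integral>\<^sup>+\<omega>. (\<Sum>j. ennreal \<bar>\<psi> j * \<epsilon> (t - int j) \<omega>\<bar>) \<partial>M)
    = ennreal ((\<Sum>j. \<bar>\<psi> j\<bar>) * expectation (\<lambda>\<omega>. \<bar>\<epsilon> 0 \<omega>\<bar>))"
proof -
  have "(\<integral>\<^sup>+\<omega>. (\<Sum>j. ennreal \<bar>\<psi> j * \<epsilon> (t - int j) \<omega>\<bar>) \<partial>M)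
      = (\<Sum>j. \<integral>\<^sup>+\<omega>. ennreal \<bar>\<psi> j * \<epsilon> (t - int j) \<omega>\<bar> \<partial>M)"
    by (intro nn_integral_suminf) simp
  also have "\<dots> = (\<Sum>j. ennreal \<bar>\<psi> j\<bar> * ennreal (expectation (\<lambda>\<omega>. \<bar>\<epsilon> 0 \<omega>\<bar>)))"
    by (simp add: abs_mult ennreal_mult nn_integral_cmult nn_integral_abs_noise)
  also have "\<dots> = (\<Sum>j. ennreal \<bar>\<psi> j\<bar>) * ennreal (expectation (\<lambda>\<omega>. \<bar>\<epsilon> 0 \<omega>\<bar>))"
    by simp
  also have "\<dots> = ennreal ((\<Sum>j. \<bar>\<psi> j\<bar>) * expectation (\<lambda>\<omega>. \<bar>\<epsilon> 0 \<omega>\<bar>))"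
    using assms by (simp add: suminf_ennreal2 ennreal_mult suminf_nonneg)
  finally show ?thesis .
qed

text \<open>The sum of absolute values is almost surely finite because its mean is. The integers
  being countable, one null set serves all \<open>t\<close>, as the pathwise use of the recursion
  requires.\<close>

lemma AE_summable_noise:
  assumes "summable (\<lambda>j. \<bar>\<psi> j\<bar>)"
  shows "AE \<omega> in M. \<forall>t. summable (\<lambda>j. \<bar>\<psi> j * \<epsilon> (t - int j) \<omega>\<bar>)"
proof (subst AE_all_countable, intro allI)
  fix t
  have "AE \<omega> in M. (\<Sum>j. ennreal \<bar>\<psi> j * \<epsilon> (t - int j) \<omega>\<bar>) \<noteq> \<infinity>"
    by (intro nn_integral_noteq_infinite) (simp_all add: nn_integral_abs_noise_series assms)
  then show "AE \<omega> in M. summable (\<lambda>j. \<bar>\<psi> j * \<epsilon> (t - int j) \<omega>\<bar>)"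
    by eventually_elim (auto intro!: summable_suminf_not_top)
qed

lemma nn_integral_abs_linear_process_le:
  assumes "summable (\<lambda>j. \<bar>\<psi> j\<bar>)"
  shows "(\<integral>\<^sup>+\<omega>. ennreal \<bar>\<Sum>j. \<psi> j * \<epsilon> (t - int j) \<omega>\<bar> \<partial>M)
    \<le> ennreal ((\<Sum>j. \<bar>\<psi> j\<bar>) * expectation (\<lambda>\<omega>. \<bar>\<epsilon> 0 \<omega>\<bar>))"
proof -
  have "AE \<omega> in M. ennreal \<bar>\<Sum>j. \<psi> j * \<epsilon> (t - int j) \<omega>\<bar> \<le> (\<Sum>j. ennreal \<bar>\<psi> j * \<epsilon> (t - int j) \<omega>\<bar>)"
    using AE_summable_noise[OF assms]
  proof eventually_elim
    case (elim \<omega>)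
    then have "\<bar>\<Sum>j. \<psi> j * \<epsilon> (t - int j) \<omega>\<bar> \<le> (\<Sum>j. \<bar>\<psi> j * \<epsilon> (t - int j) \<omega>\<bar>)"
      by (intro summable_rabs) auto
    then show ?case
      using elim by (simp add: suminf_ennreal2 ennreal_leI)
  qed
  then show ?thesis
    unfolding nn_integral_abs_noise_series[OF assms, of t, symmetric] by (rule nn_integral_mono_AE)
qed

text \<open>Weighted Cauchy-Schwarz: the square of the series is at most \<open>\<Psi>\<close> times
  the series with weights \<open>|\<psi> j|\<close> in the squared innovations, whose mean is a
  first moment computation. The inequality is shown for partial sums and passes to the
  limit.\<close>

lemma nn_integral_linear_process_square_le:
  assumes psi: "summable (\<lambda>j. \<bar>\<psi> j\<bar>)" and sq: "integrable M (\<lambda>\<omega>. (\<epsilon> 0 \<omega>)\<^sup>2)"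
  shows "(\<integral>\<^sup>+\<omega>. ennreal ((\<Sum>j. \<psi> j * \<epsilon> (t - int j) \<omega>)\<^sup>2) \<partial>M)
    \<le> ennreal ((\<Sum>j. \<bar>\<psi> j\<bar>)\<^sup>2 * expectation (\<lambda>\<omega>. (\<epsilon> 0 \<omega>)\<^sup>2))"
proof -
  define \<Psi> where "\<Psi> = (\<Sum>j. \<bar>\<psi> j\<bar>)"
  have "\<Psi> \<ge> 0"
    unfolding \<Psi>_def by (intro suminf_nonneg psi) simp
  interpret sq: iid_sequence M "\<lambda>t \<omega>. (\<epsilon> t \<omega>)\<^sup>2"
    using iid_comp[of "\<lambda>x. x\<^sup>2"] sq by unfold_locales auto
  have psi': "summable (\<lambda>j. \<bar>\<bar>\<psi> j\<bar>\<bar>)"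
    using psi by simp
  have "AE \<omega> in M. ennreal ((\<Sum>j. \<psi> j * \<epsilon> (t - int j) \<omega>)\<^sup>2)
      \<le> ennreal \<Psi> * (\<Sum>j. ennreal \<bar>\<bar>\<psi> j\<bar> * (\<epsilon> (t - int j) \<omega>)\<^sup>2\<bar>)"
    using AE_summable_noise[OF psi] sq.AE_summable_noise[OF psi']
  proof eventually_elim
    case (elim \<omega>)
    let ?e = "\<lambda>j. \<epsilon> (t - int j) \<omega>"
    have s1: "summable (\<lambda>j. \<psi> j * ?e j)" and s2: "summable (\<lambda>j. \<bar>\<psi> j\<bar> * (?e j)\<^sup>2)"
      using elim summable_rabs_cancel by (auto simp: abs_mult)
    have "(\<Sum>j<n. \<psi> j * ?e j)\<^sup>2 \<le> \<Psi> * (\<Sum>j. \<bar>\<psi> j\<bar> * (?e j)\<^sup>2)" for n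
    proof -
      have "\<bar>\<Sum>j<n. \<psi> j * ?e j\<bar> \<le> (\<Sum>j<n. sqrt \<bar>\<psi> j\<bar> * (sqrt \<bar>\<psi> j\<bar> * \<bar>?e j\<bar>))"
        by (rule order_trans[OF sum_abs]) (simp add: abs_mult mult.assoc[symmetric])
      then have "(\<Sum>j<n. \<psi> j * ?e j)\<^sup>2 \<le> (\<Sum>j<n. sqrt \<bar>\<psi> j\<bar> * (sqrt \<bar>\<psi> j\<bar> * \<bar>?e j\<bar>))\<^sup>2"
        by (subst abs_le_square_iff[symmetric]) linarith
      also have "\<dots> \<le> (\<Sum>j<n. (sqrt \<bar>\<psi> j\<bar>)\<^sup>2) * (\<Sum>j<n. (sqrt \<bar>\<psi> j\<bar> * \<bar>?e j\<bar>)\<^sup>2)"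
        by (rule Cauchy_Schwarz_ineq_sum)
      also have "\<dots> = (\<Sum>j<n. \<bar>\<psi> j\<bar>) * (\<Sum>j<n. \<bar>\<psi> j\<bar> * (?e j)\<^sup>2)"
        by (simp add: power_mult_distrib)
      also have "\<dots> \<le> \<Psi> * (\<Sum>j. \<bar>\<psi> j\<bar> * (?e j)\<^sup>2)"
        unfolding \<Psi>_def using psi s2
        by (intro mult_mono sum_le_suminf sum_nonneg suminf_nonneg) auto
      finally show ?thesis .
    qed
    moreover have "(\<lambda>n. (\<Sum>j<n. \<psi> j * ?e j)\<^sup>2) \<longlonglongrightarrow> (\<Sum>j. \<psi> j * ?e j)\<^sup>2"
      using summable_LIMSEQ[OF s1] by (intro tendsto_power)
    ultimately have "(\<Sum>j. \<psi> j * ?e j)\<^sup>2 \<le> \<Psi> * (\<Sum>j. \<bar>\<psi> j\<bar> * (?e j)\<^sup>2)"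
      by (intro LIMSEQ_le_const2) auto
    then show ?case
      using s2 \<open>\<Psi> \<ge> 0\<close> by (simp add: abs_mult suminf_ennreal2 ennreal_mult[symmetric] suminf_nonneg ennreal_leI)
  qed
  then have "(\<integral>\<^sup>+\<omega>. ennreal ((\<Sum>j. \<psi> j * \<epsilon> (t - int j) \<omega>)\<^sup>2) \<partial>M)
      \<le> (\<integral>\<^sup>+\<omega>. ennreal \<Psi> * (\<Sum>j. ennreal \<bar>\<bar>\<psi> j\<bar> * (\<epsilon> (t - int j) \<omega>)\<^sup>2\<bar>) \<partial>M)"
    by (rule nn_integral_mono_AE)
  also have "\<dots> = ennreal \<Psi> * (\<integral>\<^sup>+\<omega>. (\<Sum>j. ennreal \<bar>\<bar>\<psi> j\<bar> * (\<epsilon> (t - int j) \<omega>)\<^sup>2\<bar>) \<partial>M)"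
    by (rule nn_integral_cmult) measurable
  also have "\<dots> = ennreal \<Psi> * ennreal (\<Psi> * expectation (\<lambda>\<omega>. (\<epsilon> 0 \<omega>)\<^sup>2))"
    unfolding sq.nn_integral_abs_noise_series[OF psi'] by (simp add: \<Psi>_def)
  also have "\<dots> = ennreal (\<Psi>\<^sup>2 * expectation (\<lambda>\<omega>. (\<epsilon> 0 \<omega>)\<^sup>2))"
    using \<open>\<Psi> \<ge> 0\<close> by (simp add: ennreal_mult[symmetric] power2_eq_square mult.assoc)
  finally show ?thesis
    by (simp add: \<Psi>_def)
qed

text \<open>The law of the path is a product of equal factors, and such a product is invariant under
  the injective reindexing \<open>t \<mapsto> t + m\<close>.\<close>

lemma stationary_noise: "stationary M \<epsilon>"
  unfolding stationary_def
proof
  fix m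
  let ?P = "PiM UNIV (\<lambda>_. borel) :: (int \<Rightarrow> real) measure"
  let ?Q = "PiM UNIV (\<lambda>_. distr M borel (\<epsilon> 0)) :: (int \<Rightarrow> real) measure"
  have "(\<lambda>i. distr M borel (\<epsilon> i)) = (\<lambda>_. distr M borel (\<epsilon> 0))"
    by (intro ext distr_noise)
  then have law: "distr M ?P (\<lambda>\<omega> t. \<epsilon> t \<omega>) = ?Q"
    using indep by (subst (asm) indep_vars_iff_distr_eq_PiM) (simp_all add: restrict_def)
  have sets: "sets ?P = sets ?Q"
    by (intro sets_PiM_cong) auto
  have path: "(\<lambda>\<omega> t. \<epsilon> t \<omega>) \<in> M \<rightarrow>\<^sub>M ?P"
    by (intro measurable_path measurable_noise)
  have shift: "(\<lambda>f t. f (t + m)) \<in> ?P \<rightarrow>\<^sub>M ?P"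
    by (intro measurable_path) simp
  have "distr M ?P (\<lambda>\<omega> t. \<epsilon> (t + m) \<omega>) = distr (distr M ?P (\<lambda>\<omega> t. \<epsilon> t \<omega>)) ?P (\<lambda>f t. f (t + m))"
    by (subst distr_distr[OF shift path]) (simp add: comp_def)
  also have "\<dots> = distr ?Q ?Q (\<lambda>f. \<lambda>t\<in>UNIV. f (t + m))"
    unfolding law by (intro distr_cong) (auto simp: sets)
  also have "\<dots> = ?Q"
    using distr_PiM_reindex[of UNIV "\<lambda>_. distr M borel (\<epsilon> 0)" "\<lambda>t. t + m" UNIV]
    by (simp add: prob_space_distr)
  finally show "distr M ?P (\<lambda>\<omega> t. \<epsilon> (t + m) \<omega>) = distr M ?P (\<lambda>\<omega> t. \<epsilon> t \<omega>)"
    by (simp add: law)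
qed

text \<open>A moving average is a fixed measurable map of the path that commutes with shifts.
  \<open>suminf\<close> is total and measurable also where the series diverges, so the map is
  defined on the whole path space for arbitrary \<open>\<psi>\<close>.\<close>

lemma stationary_linear_process: "stationary M (\<lambda>t \<omega>. \<Sum>j. \<psi> j * \<epsilon> (t - int j) \<omega>)"
  unfolding stationary_def
proof
  fix m
  let ?P = "PiM UNIV (\<lambda>_. borel) :: (int \<Rightarrow> real) measure"
  let ?F = "\<lambda>e t. \<Sum>j. \<psi> j * e (t - int j)"
  have F: "?F \<in> ?P \<rightarrow>\<^sub>M ?P"
    by (intro measurable_path) simp
  have path: "(\<lambda>\<omega> t. \<epsilon> (t + m) \<omega>) \<in> M \<rightarrow>\<^sub>M ?P" for m
    by (intro measurable_path measurable_noise)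
  have "distr M ?P (\<lambda>\<omega> t. \<Sum>j. \<psi> j * \<epsilon> (t + m - int j) \<omega>)
      = distr (distr M ?P (\<lambda>\<omega> t. \<epsilon> (t + m) \<omega>)) ?P ?F" for m
    by (subst distr_distr[OF F path]) (simp add: comp_def algebra_simps)
  from this[of m] this[of 0] show "distr M ?P (\<lambda>\<omega> t. \<Sum>j. \<psi> j * \<epsilon> (t + m - int j) \<omega>)
      = distr M ?P (\<lambda>\<omega> t. \<Sum>j. \<psi> j * \<epsilon> (t - int j) \<omega>)"
    using stationary_noise unfolding stationary_def by simp
qed

text \<open>Provides the existence premise of \<open>stationary_regime\<close> and the comparison
  process for the uniqueness argument.\<close>

lemma ma_process_stationary_causal_solution:
  assumes "summable (\<lambda>j. \<bar>ma_coeff p \<theta> j\<bar>)"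
  shows "stationary_causal_solution M p \<theta> \<epsilon> (\<lambda>t \<omega>. \<Sum>j. ma_coeff p \<theta> j * \<epsilon> (t - int j) \<omega>)"
  unfolding stationary_causal_solution_def ar_solution_def causal_def
proof (intro conjI allI exI[of _ "ma_coeff p \<theta>"])
  fix t
  show "AE \<omega> in M. (\<Sum>j. ma_coeff p \<theta> j * \<epsilon> (t - int j) \<omega>)
      = ar_pred p \<theta> (\<lambda>u. \<Sum>j. ma_coeff p \<theta> j * \<epsilon> (u - int j) \<omega>) t + \<epsilon> t \<omega>"
    using AE_summable_noise[OF assms]
    by eventually_elim (rule ma_series_solves_ar, rule summable_rabs_cancel, blast)
  show "AE \<omega> in M. (\<lambda>j. ma_coeff p \<theta> j * \<epsilon> (t - int j) \<omega>) sums (\<Sum>j. ma_coeff p \<theta> j * \<epsilon> (t - int j) \<omega>)"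
    using AE_summable_noise[OF assms]
    by eventually_elim (rule summable_sums, rule summable_rabs_cancel, blast)
qed (simp_all add: assms stationary_linear_process)

lemma stationary_ar_solution_eq_ma:
  assumes "ar_solution M p \<theta> \<epsilon> X" "stationary M X"
    and "\<And>j. \<bar>ma_coeff p \<theta> j\<bar> \<le> C * r ^ j" "0 < r" "r < 1"
  shows "AE \<omega> in M. X t \<omega> = (\<Sum>j. ma_coeff p \<theta> j * \<epsilon> (t - int j) \<omega>)"
proof -
  have "summable (\<lambda>j. \<bar>ma_coeff p \<theta> j\<bar>)"
    using assms(3-5) by (rule summable_abs_of_geometric_bound)
  note sol = ma_process_stationary_causal_solution[OF this, unfolded stationary_causal_solution_def]
  show ?thesis
    by (rule stationary_ar_solution_unique[OF assms(1,2) _ _ assms(3-5)]) (use sol in simp_all)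
qed

end

section \<open>The empirical variance of the residuals\<close>

context iid_sequence
begin

text \<open>One half of the weak law of large numbers. Only a first moment is available (the lemma is
  applied to squared innovations), so the summands are truncated first.\<close>

lemma prob_sum_ge_tendsto_0:
  assumes nonneg: "\<And>t \<omega>. 0 \<le> \<epsilon> t \<omega>" and c: "expectation (\<epsilon> 0) < c"
  shows "(\<lambda>n. prob {\<omega> \<in> space M. c * real n \<le> (\<Sum>t=1..int n. \<epsilon> t \<omega>)}) \<longlonglongrightarrow> 0"
proof (rule LIMSEQ_I)
  fix \<kappa> :: real
  assume "\<kappa> > 0"
  define \<gamma> where "\<gamma> = c - expectation (\<epsilon> 0)"
  have "\<gamma> > 0"
    using c by (simp add: \<gamma>_def)
  have "(\<lambda>b. expectation (\<lambda>\<omega>. \<epsilon> 0 \<omega> - min (\<epsilon> 0 \<omega>) (real b))) \<longlonglongrightarrow> expectation (\<lambda>\<omega>. 0)"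
  proof (rule integral_dominated_convergence[where w = "\<epsilon> 0"])
    show "AE \<omega> in M. (\<lambda>b. \<epsilon> 0 \<omega> - min (\<epsilon> 0 \<omega>) (real b)) \<longlonglongrightarrow> 0"
    proof (rule AE_I2, rule tendsto_eventually)
      fix \<omega>
      obtain b0 :: nat where "\<epsilon> 0 \<omega> \<le> real b0"
        using real_arch_simple by blast
      then show "\<forall>\<^sub>F b in sequentially. \<epsilon> 0 \<omega> - min (\<epsilon> 0 \<omega>) (real b) = 0"
        by (intro eventually_sequentiallyI[of b0]) auto
    qed
  qed (use nonneg integrable_0 in auto)
  then have "\<forall>\<^sub>F b in sequentially. expectation (\<lambda>\<omega>. \<epsilon> 0 \<omega> - min (\<epsilon> 0 \<omega>) (real b)) < \<kappa> * \<gamma> / 4"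
    using \<open>\<kappa> > 0\<close> \<open>\<gamma> > 0\<close> by (intro order_tendstoD) auto
  then have "\<forall>\<^sub>F b in sequentially. expectation (\<lambda>\<omega>. \<epsilon> 0 \<omega> - min (\<epsilon> 0 \<omega>) (real b)) < \<kappa> * \<gamma> / 4 \<and> b > 0"
    using eventually_gt_at_top by (rule eventually_conj)
  \<comment> \<open>The mean excess over the level \<open>b\<close> is below
    \<open>\<kappa> * \<gamma> / 4\<close>, so Markov's inequality at height
    \<open>real n * \<gamma> / 2\<close> costs at most \<open>\<kappa> / 2\<close>, uniformly in
    \<open>n\<close>. \<open>b > 0\<close> keeps the range \<open>[0, b]\<close> for Hoeffding's
    inequality nondegenerate.\<close>
  then obtain b :: nat where b: "expectation (\<lambda>\<omega>. \<epsilon> 0 \<omega> - min (\<epsilon> 0 \<omega>) (real b)) < \<kappa> * \<gamma> / 4" "b > 0"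
    by (auto simp: eventually_sequentially)
  define Y where "Y = (\<lambda>t \<omega>. min (\<epsilon> t \<omega>) (real b))"
  define V where "V = (\<lambda>t \<omega>. \<epsilon> t \<omega> - Y t \<omega>)"
  have [measurable]: "Y t \<in> borel_measurable M" "V t \<in> borel_measurable M" for t
    by (simp_all add: Y_def V_def)
  have V_nonneg: "0 \<le> V t \<omega>" and Y_range: "0 \<le> Y t \<omega>" "Y t \<omega> \<le> real b" for t \<omega>
    using nonneg[of t \<omega>] by (auto simp: V_def Y_def)
  have int_Y: "integrable M (Y t)" for t
    by (rule integrable_const_bound[where B = "real b"]) (use Y_range in auto)
  have int_V: "integrable M (V t)" for t
  proof -
    have "integrable M (V 0)"
      unfolding V_def by (intro Bochner_Integration.integrable_diff integrable_0 int_Y)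
    then show ?thesis
      using integrable_distr_eq_iff[OF distr_noise[of t], of "\<lambda>x. x - min x (real b)"]
      by (simp add: V_def Y_def)
  qed
  have E_V: "expectation (V t) = expectation (V 0)" for t
    unfolding V_def Y_def
    by (rule integral_distr_eq[OF distr_noise, where f = "\<lambda>x. x - min x (real b)"]) auto
  have E_sum_V: "expectation (\<lambda>\<omega>. \<Sum>t=1..int n. V t \<omega>) = real n * expectation (V 0)" for n
  proof -
    have "expectation (\<lambda>\<omega>. \<Sum>t=1..int n. V t \<omega>) = (\<Sum>t=1..int n. expectation (V t))"
      by (intro Bochner_Integration.integral_sum int_V)
    also have "\<dots> = (\<Sum>t=1..int n. expectation (V 0))"
      by (intro sum.cong refl E_V)
    finally show ?thesis
      by simp
  qed
  have E_Y: "expectation (Y 0) \<le> expectation (\<epsilon> 0)"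
    by (intro integral_mono int_Y integrable_0) (simp add: Y_def)
  have iid_Y: "iid M Y"
    unfolding Y_def by (rule iid_comp) simp
  define q where "q = exp (- (\<gamma>\<^sup>2 / (2 * (real b)\<^sup>2)))"
  have bound: "prob {\<omega> \<in> space M. c * real n \<le> (\<Sum>t=1..int n. \<epsilon> t \<omega>)} \<le> q ^ n + \<kappa> / 2"
    if "n \<ge> 1" for n
  proof -
    let ?S = "\<lambda>V \<omega>. \<Sum>t=1..int n. V t \<omega>"
    have "prob {\<omega> \<in> space M. c * real n \<le> ?S \<epsilon> \<omega>}
        \<le> prob ({\<omega> \<in> space M. real n * expectation (Y 0) + real n * \<gamma> / 2 \<le> ?S Y \<omega>}
          \<union> {\<omega> \<in> space M. real n * \<gamma> / 2 \<le> ?S V \<omega>})"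
    \<comment> \<open>The gap \<open>\<gamma>\<close> is shared equally: if the truncated parts
      exceed their mean by less than \<open>real n * \<gamma> / 2\<close> in total and the excesses
      sum to less than that, the whole sum stays below \<open>c * real n\<close>, because truncation
      only lowers the mean.\<close>
    proof (rule finite_measure_mono)
      have "real n * expectation (Y 0) \<le> real n * expectation (\<epsilon> 0)"
        using E_Y by (intro mult_left_mono) auto
      then have "real n * expectation (Y 0) + real n * \<gamma> \<le> c * real n"
        by (simp add: \<gamma>_def algebra_simps)
      moreover have "?S \<epsilon> \<omega> = ?S Y \<omega> + ?S V \<omega>" for \<omega>
        by (simp add: V_def sum_subtractf)
      ultimately show "{\<omega> \<in> space M. c * real n \<le> ?S \<epsilon> \<omega>}
          \<subseteq> {\<omega> \<in> space M. real n * expectation (Y 0) + real n * \<gamma> / 2 \<le> ?S Y \<omega>}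
          \<union> {\<omega> \<in> space M. real n * \<gamma> / 2 \<le> ?S V \<omega>}"
        by fastforce
    qed measurable
    also have "\<dots> \<le> prob {\<omega> \<in> space M. real n * expectation (Y 0) + real n * \<gamma> / 2 \<le> ?S Y \<omega>}
        + prob {\<omega> \<in> space M. real n * \<gamma> / 2 \<le> ?S V \<omega>}"
      by (rule measure_Un_le) measurable
    also have "prob {\<omega> \<in> space M. real n * \<gamma> / 2 \<le> ?S V \<omega>} \<le> expectation (?S V) / (real n * \<gamma> / 2)"
      using that \<open>\<gamma> > 0\<close> int_V V_nonneg
      by (intro integral_Markov_inequality_measure[where A = "{}"]) (auto intro!: sum_nonneg)
    also have "expectation (?S V) = real n * expectation (V 0)"
      by (rule E_sum_V)
    also have "real n * expectation (V 0) / (real n * \<gamma> / 2) \<le> \<kappa> / 2"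
      using b(1) that \<open>\<gamma> > 0\<close> by (simp add: V_def Y_def field_simps)
    also have "prob {\<omega> \<in> space M. real n * expectation (Y 0) + real n * \<gamma> / 2 \<le> ?S Y \<omega>} \<le> q ^ n"
    proof -
      interpret H: Hoeffding_ineq_iid M "{1..int n}" Y "Y 0" 0 "real b" "expectation (Y 0)"
      proof unfold_locales
        show "indep_vars (\<lambda>_. borel) Y {1..int n}"
          using iid_Y by (auto simp: iid_def intro: indep_vars_subset)
        show "distr M borel (Y i) = distr M borel (Y 0)" for i
          using iid_Y by (simp add: iid_def)
      qed (use Y_range in auto)
      have "prob {\<omega> \<in> space M. real n * expectation (Y 0) + real n * \<gamma> / 2 \<le> ?S Y \<omega>}
          \<le> exp (-2 * (real n * \<gamma> / 2)\<^sup>2 / (real n * (real b - 0)\<^sup>2))"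
        using H.Hoeffding_ineq_ge[of "real n * \<gamma> / 2"] that b(2) \<open>\<gamma> > 0\<close> by simp
      also have "-2 * (real n * \<gamma> / 2)\<^sup>2 / (real n * (real b - 0)\<^sup>2)
          = real n * - (\<gamma>\<^sup>2 / (2 * (real b)\<^sup>2))"
        using that by (simp add: power2_eq_square field_simps)
      also have "exp \<dots> = q ^ n"
        unfolding q_def by (rule exp_of_nat_mult)
      finally show ?thesis .
    qed
    finally show ?thesis
      by simp
  qed
  have "q < 1" "q > 0"
    using b(2) \<open>\<gamma> > 0\<close> by (auto simp: q_def)
  then have "(\<lambda>n. q ^ n) \<longlonglongrightarrow> 0"
    by (intro LIMSEQ_realpow_zero) auto
  then have "\<forall>\<^sub>F n in sequentially. q ^ n < \<kappa> / 2"
    using \<open>\<kappa> > 0\<close> by (intro order_tendstoD) auto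
  then have "\<forall>\<^sub>F n in sequentially. q ^ n < \<kappa> / 2 \<and> n \<ge> 1"
    using eventually_ge_at_top by (rule eventually_conj)
  then obtain n0 where n0: "\<And>n. n \<ge> n0 \<Longrightarrow> q ^ n < \<kappa> / 2 \<and> n \<ge> 1"
    by (auto simp: eventually_sequentially)
  have "norm (prob {\<omega> \<in> space M. c * real n \<le> (\<Sum>t=1..int n. \<epsilon> t \<omega>)} - 0) < \<kappa>" if "n \<ge> n0" for n
    using bound[of n] n0[OF that] by simp
  then show "\<exists>no. \<forall>n\<ge>no. norm (prob {\<omega> \<in> space M. c * real n \<le> (\<Sum>t=1..int n. \<epsilon> t \<omega>)} - 0) < \<kappa>"
    by blast
qed

lemma stationary_ar_second_moment:
  assumes "ar_solution M p \<theta> \<epsilon> X" "stationary M X"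
    and psi: "\<And>j. \<bar>ma_coeff p \<theta> j\<bar> \<le> C * r ^ j" "0 < r" "r < 1"
    and sq: "integrable M (\<lambda>\<omega>. (\<epsilon> 0 \<omega>)\<^sup>2)"
  defines "B \<equiv> (\<Sum>j. \<bar>ma_coeff p \<theta> j\<bar>)\<^sup>2 * expectation (\<lambda>\<omega>. (\<epsilon> 0 \<omega>)\<^sup>2)"
  shows "integrable M (\<lambda>\<omega>. (X t \<omega>)\<^sup>2)" "expectation (\<lambda>\<omega>. (X t \<omega>)\<^sup>2) \<le> B"
proof -
  have [measurable]: "X t \<in> borel_measurable M"
    using assms(1) by (simp add: ar_solution_def)
  have "summable (\<lambda>j. \<bar>ma_coeff p \<theta> j\<bar>)"
    using psi by (rule summable_abs_of_geometric_bound)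
  then have "(\<integral>\<^sup>+\<omega>. ennreal ((\<Sum>j. ma_coeff p \<theta> j * \<epsilon> (t - int j) \<omega>)\<^sup>2) \<partial>M) \<le> ennreal B"
    unfolding B_def using sq by (rule nn_integral_linear_process_square_le)
  moreover have "(\<integral>\<^sup>+\<omega>. ennreal ((X t \<omega>)\<^sup>2) \<partial>M)
      = (\<integral>\<^sup>+\<omega>. ennreal ((\<Sum>j. ma_coeff p \<theta> j * \<epsilon> (t - int j) \<omega>)\<^sup>2) \<partial>M)"
    using stationary_ar_solution_eq_ma[OF assms(1,2) psi, of t] by (intro nn_integral_cong_AE) auto
  ultimately have le: "(\<integral>\<^sup>+\<omega>. ennreal ((X t \<omega>)\<^sup>2) \<partial>M) \<le> ennreal B"
    by simp
  have "B \<ge> 0"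
    by (simp add: B_def)
  show "integrable M (\<lambda>\<omega>. (X t \<omega>)\<^sup>2)"
    using le by (intro integrableI_bounded) (auto simp: le_less_trans[OF _ ennreal_less_top])
  then show "expectation (\<lambda>\<omega>. (X t \<omega>)\<^sup>2) \<le> B"
    using le \<open>B \<ge> 0\<close> by (simp add: nn_integral_eq_integral)
qed

end

section \<open>From innovations to residuals\<close>

text \<open>The residual is the innovation plus the inner product of the estimation error with the
  lagged observations. That product is at most the l1 size of the error times the largest lagged
  value, itself at most the root of the sum of squares.\<close>

lemma residual_estimation_error:
  assumes "x t = ar_pred p \<theta> x t + e"
  shows "(residual p \<theta>' x t)\<^sup>2 \<le> 2 * e\<^sup>2 + 2 * (l1_dist p \<theta>' \<theta>)\<^sup>2 * (\<Sum>j=1..p. (x (t - int j))\<^sup>2)"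
proof -
  define W where "W = (\<Sum>j=1..p. (x (t - int j))\<^sup>2)"
  define d where "d = (\<Sum>j=1..p. (\<theta> j - \<theta>' j) * x (t - int j))"
  have "W \<ge> 0"
    by (simp add: W_def sum_nonneg)
  have "\<bar>x (t - int j)\<bar> \<le> sqrt W" if "j \<in> {1..p}" for j
  proof -
    have "(x (t - int j))\<^sup>2 \<le> W"
      unfolding W_def using that by (intro member_le_sum) auto
    then show ?thesis
      by (metis real_sqrt_abs real_sqrt_le_iff)
  qed
  then have "\<bar>d\<bar> \<le> (\<Sum>j=1..p. \<bar>\<theta>' j - \<theta> j\<bar> * sqrt W)"
    unfolding d_def
    by (intro order_trans[OF sum_abs] sum_mono) (auto simp: abs_mult abs_minus_commute intro: mult_left_mono)
  also have "\<dots> = l1_dist p \<theta>' \<theta> * sqrt W"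
    by (simp add: l1_dist_def sum_distrib_right)
  finally have "d\<^sup>2 \<le> (l1_dist p \<theta>' \<theta> * sqrt W)\<^sup>2"
    by (metis abs_ge_zero power2_abs power_mono)
  also have "\<dots> = (l1_dist p \<theta>' \<theta>)\<^sup>2 * W"
    using \<open>W \<ge> 0\<close> by (simp add: power_mult_distrib)
  finally have "d\<^sup>2 \<le> (l1_dist p \<theta>' \<theta>)\<^sup>2 * W" .
  moreover have "residual p \<theta>' x t = e + d"
    using assms by (simp add: residual_def ar_pred_def d_def left_diff_distrib sum_subtractf)
  moreover have "(e + d)\<^sup>2 \<le> 2 * e\<^sup>2 + 2 * d\<^sup>2"
    using sum_squares_bound[of e d] by (simp add: power2_sum)
  ultimately show ?thesis
    by (simp add: W_def)
qed

text \<open>Centring at the sample mean lowers a sum of squares by the squared total divided by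
  \<open>n\<close>.\<close>

lemma sum_centred_residual_square_le:
  "(\<Sum>t=1..int n. (centred_residual p \<theta> x n t)\<^sup>2) \<le> (\<Sum>t=1..int n. (residual p \<theta> x t)\<^sup>2)"
proof (cases "n = 0")
  case False
  define S where "S = (\<Sum>s=1..int n. residual p \<theta> x s)"
  have "(\<Sum>t=1..int n. (centred_residual p \<theta> x n t)\<^sup>2)
      = (\<Sum>t=1..int n. (residual p \<theta> x t)\<^sup>2 - 2 * (S / n) * residual p \<theta> x t + (S / n)\<^sup>2)"
    by (intro sum.cong) (simp_all add: centred_residual_def S_def power2_diff)
  also have "\<dots> = (\<Sum>t=1..int n. (residual p \<theta> x t)\<^sup>2) - 2 * (S / n) * S + n * (S / n)\<^sup>2"
    by (simp only: sum.distrib sum_subtractf sum_distrib_left[symmetric] S_def[symmetric]) simp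
  also have "\<dots> = (\<Sum>t=1..int n. (residual p \<theta> x t)\<^sup>2) - S\<^sup>2 / n"
    using False by (simp add: power2_eq_square field_simps)
  finally show ?thesis
    by simp
qed simp

context iid_sequence
begin

text \<open>The threshold is \<open>8 = 2 * 3 + 2 * 1\<close>: outside three exceptional events the
  squared innovations contribute at most \<open>3 * \<sigma>2\<close> per observation, and the
  squared estimation error times the lagged squares at most \<open>\<sigma>2\<close>. The 3 leaves
  the weak law room above the mean.\<close>

lemma prob_residual_variance_tendsto_0:
  assumes X: "ar_solution M p \<theta> \<epsilon> X" "stationary M X"
    and psi: "\<And>j. \<bar>ma_coeff p \<theta> j\<bar> \<le> C * r ^ j" "0 < r" "r < 1"
    and sq: "integrable M (\<lambda>\<omega>. (\<epsilon> 0 \<omega>)\<^sup>2)"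
    and cons: "consistent M p \<theta>h \<theta>"
    and meas: "\<And>n j. n \<ge> 1 \<Longrightarrow> j \<in> {1..p} \<Longrightarrow> (\<lambda>\<omega>. \<theta>h n \<omega> j) \<in> borel_measurable M"
  defines "\<sigma>2 \<equiv> expectation (\<lambda>\<omega>. (\<epsilon> 0 \<omega>)\<^sup>2)"
  shows "(\<lambda>n. prob {\<omega> \<in> space M. 8 * \<sigma>2 * real n
    < (\<Sum>t=1..int n. (residual p (\<theta>h n \<omega>) (\<lambda>t. X t \<omega>) t)\<^sup>2)}) \<longlonglongrightarrow> 0"
proof -
  have [measurable]: "X t \<in> borel_measurable M" for t
    using X(1) by (simp add: ar_solution_def)
  have [measurable]: "(\<lambda>\<omega>. l1_dist p (\<theta>h n \<omega>) \<theta>) \<in> borel_measurable M" if "n \<ge> 1" for n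
    using meas[OF that] unfolding l1_dist_def by measurable
  let ?T = "\<lambda>n. {\<omega> \<in> space M. 8 * \<sigma>2 * real n < (\<Sum>t=1..int n. (residual p (\<theta>h n \<omega>) (\<lambda>t. X t \<omega>) t)\<^sup>2)}"
  let ?E = "\<lambda>n \<omega>. \<Sum>t=1..int n. (\<epsilon> t \<omega>)\<^sup>2"
  let ?Z = "\<lambda>n \<omega>. \<Sum>t=1..int n. \<Sum>j=1..p. (X (t - int j) \<omega>)\<^sup>2"
  define A where "A = (\<Sum>j. \<bar>ma_coeff p \<theta> j\<bar>)\<^sup>2"
  have "A \<ge> 0" "\<sigma>2 \<ge> 0"
    by (simp_all add: A_def \<sigma>2_def)
  note X_sq = stationary_ar_second_moment[OF X psi sq, folded \<sigma>2_def A_def]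
  have int_Z: "integrable M (?Z n)" for n
    using X_sq by auto
  have E_Z: "expectation (?Z n) \<le> real n * (real p * (A * \<sigma>2))" for n
  proof -
    have "expectation (?Z n) = (\<Sum>t=1..int n. \<Sum>j=1..p. expectation (\<lambda>\<omega>. (X (t - int j) \<omega>)\<^sup>2))"
      using X_sq by simp
    also have "\<dots> \<le> (\<Sum>t=1..int n. \<Sum>j=1..p. A * \<sigma>2)"
      by (intro sum_mono X_sq)
    finally show ?thesis
      by simp
  qed
  have ar: "AE \<omega> in M. \<forall>t. X t \<omega> = ar_pred p \<theta> (\<lambda>u. X u \<omega>) t + \<epsilon> t \<omega>"
    using X(1) by (subst AE_all_countable) (simp add: ar_solution_def)
  have res: "(\<Sum>t=1..int n. (residual p (\<theta>h n \<omega>) (\<lambda>t. X t \<omega>) t)\<^sup>2)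
      \<le> 2 * ?E n \<omega> + 2 * (l1_dist p (\<theta>h n \<omega>) \<theta>)\<^sup>2 * ?Z n \<omega>"
    if "\<forall>t. X t \<omega> = ar_pred p \<theta> (\<lambda>u. X u \<omega>) t + \<epsilon> t \<omega>" for n \<omega>
    unfolding sum_distrib_left sum.distrib[symmetric]
    unfolding sum_distrib_left[symmetric]
    by (intro sum_mono residual_estimation_error that[rule_format])
  interpret sq: iid_sequence M "\<lambda>t \<omega>. (\<epsilon> t \<omega>)\<^sup>2"
    using iid_comp[of "\<lambda>x. x\<^sup>2"] sq by unfold_locales auto
  show ?thesis
  \<comment> \<open>With zero variance the thresholds leave no room above the mean; but then
    \<open>X\<close> vanishes almost surely, and so do all residuals.\<close>
  proof (cases "\<sigma>2 = 0")
    case True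
    have null_X: "AE \<omega> in M. \<forall>t. X t \<omega> = 0"
    proof (subst AE_all_countable, intro allI)
      fix t
      have "expectation (\<lambda>\<omega>. (X t \<omega>)\<^sup>2) = 0"
        using X_sq(2)[of t] True by (intro antisym) auto
      then show "AE \<omega> in M. X t \<omega> = 0"
        using X_sq(1)[of t] by (subst (asm) integral_nonneg_eq_0_iff_AE) auto
    qed
    have "AE \<omega> in M. \<omega> \<notin> ?T n" for n
      using null_X
    proof (rule eventually_mono)
      fix \<omega>
      assume "\<forall>t. X t \<omega> = 0"
      then show "\<omega> \<notin> ?T n"
        by (simp add: residual_def ar_pred_def True)
    qed
    then have "prob (?T n) \<le> prob {}" for n
      by (intro finite_measure_mono_AE) auto
    then have "prob (?T n) = 0" for n
      by (simp add: measure_le_0_iff)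
    then show ?thesis
      by simp
  next
    case False
    then have "\<sigma>2 > 0"
      using \<open>\<sigma>2 \<ge> 0\<close> by simp
    show ?thesis
    proof (rule LIMSEQ_I)
      fix \<kappa> :: real
      assume "\<kappa> > 0"
      \<comment> \<open>By Markov's inequality \<open>?W n\<close> below has probability at most
        \<open>real p * A * \<delta>\<^sup>2\<close> for every \<open>n \<ge> 1\<close>;
        \<open>\<delta>\<close> is chosen to make this at most \<open>\<kappa> / 3\<close>. The
        summand 1 makes \<open>P\<close> positive.\<close>
      define P where "P = real p * A + 1"
      define \<delta> where "\<delta> = sqrt (\<kappa> / (3 * P))"
      have "P > 0"
        unfolding P_def using \<open>A \<ge> 0\<close> by (intro add_nonneg_pos) auto
      then have "\<delta> > 0" "\<delta>\<^sup>2 = \<kappa> / (3 * P)"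
        using \<open>\<kappa> > 0\<close> by (simp_all add: \<delta>_def)
      have "real p * A * \<delta>\<^sup>2 \<le> P * \<delta>\<^sup>2"
        unfolding P_def by (intro mult_right_mono) auto
      also have "\<dots> = \<kappa> / 3"
        using \<open>P > 0\<close> by (simp add: \<open>\<delta>\<^sup>2 = _\<close>)
      finally have small: "real p * A * \<delta>\<^sup>2 \<le> \<kappa> / 3" .
      let ?L = "\<lambda>n. {\<omega> \<in> space M. \<delta> < l1_dist p (\<theta>h n \<omega>) \<theta>}"
      let ?V = "\<lambda>n. {\<omega> \<in> space M. 3 * \<sigma>2 * real n \<le> ?E n \<omega>}"
      let ?W = "\<lambda>n. {\<omega> \<in> space M. real n * \<sigma>2 / \<delta>\<^sup>2 \<le> ?Z n \<omega>}"
      have bound: "prob (?T n) \<le> prob (?L n) + prob (?V n) + \<kappa> / 3" if "n \<ge> 1" for n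
      proof -
        have [measurable]: "?L n \<in> sets M" "?V n \<in> sets M" "?W n \<in> sets M"
          using that by measurable
        have "prob (?T n) \<le> prob (?L n \<union> ?V n \<union> ?W n)"
        proof (rule finite_measure_mono_AE)
          show "AE \<omega> in M. \<omega> \<in> ?T n \<longrightarrow> \<omega> \<in> ?L n \<union> ?V n \<union> ?W n"
          proof (rule eventually_mono[OF ar], intro impI, rule ccontr)
            fix \<omega>
            assume eq: "\<forall>t. X t \<omega> = ar_pred p \<theta> (\<lambda>u. X u \<omega>) t + \<epsilon> t \<omega>"
              and T: "\<omega> \<in> ?T n" and LVW: "\<omega> \<notin> ?L n \<union> ?V n \<union> ?W n"
            from T LVW have 1: "8 * \<sigma>2 * real n < (\<Sum>t=1..int n. (residual p (\<theta>h n \<omega>) (\<lambda>t. X t \<omega>) t)\<^sup>2)"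
              and 2: "l1_dist p (\<theta>h n \<omega>) \<theta> \<le> \<delta>" "?E n \<omega> < 3 * \<sigma>2 * real n" "?Z n \<omega> < real n * \<sigma>2 / \<delta>\<^sup>2"
              by auto
            have "(l1_dist p (\<theta>h n \<omega>) \<theta>)\<^sup>2 * ?Z n \<omega> \<le> \<delta>\<^sup>2 * ?Z n \<omega>"
              using 2(1) by (intro mult_right_mono power_mono sum_nonneg) (auto simp: l1_dist_def sum_nonneg)
            also have "\<dots> \<le> real n * \<sigma>2"
              using 2(3) \<open>\<delta> > 0\<close> by (simp add: field_simps)
            finally have "(l1_dist p (\<theta>h n \<omega>) \<theta>)\<^sup>2 * ?Z n \<omega> \<le> real n * \<sigma>2" .
            then have "2 * ?E n \<omega> + 2 * (l1_dist p (\<theta>h n \<omega>) \<theta>)\<^sup>2 * ?Z n \<omega> \<le> 8 * \<sigma>2 * real n"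
              using 2(2) unfolding mult.assoc by (simp only: mult.commute[of \<sigma>2])
            then show False
              using 1 res[OF eq, of n] by linarith
          qed
        qed measurable
        also have "\<dots> \<le> prob (?L n) + prob (?V n) + prob (?W n)"
          by (intro order_trans[OF measure_Un_le] add_right_mono) auto
        also have "prob (?W n) \<le> expectation (?Z n) / (real n * \<sigma>2 / \<delta>\<^sup>2)"
          using that \<open>\<sigma>2 > 0\<close> \<open>\<delta> > 0\<close> int_Z
          by (intro integral_Markov_inequality_measure[where A = "{}"]) (auto intro!: sum_nonneg)
        also have "\<dots> \<le> real n * (real p * (A * \<sigma>2)) / (real n * \<sigma>2 / \<delta>\<^sup>2)"
          using E_Z that \<open>\<sigma>2 > 0\<close> \<open>\<delta> > 0\<close> by (intro divide_right_mono) auto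
        also have "\<dots> = real p * A * \<delta>\<^sup>2"
          using that \<open>\<sigma>2 > 0\<close> by simp
        also have "\<dots> \<le> \<kappa> / 3"
          by (rule small)
        finally show ?thesis
          by simp
      qed
      have "(\<lambda>n. prob (?L n)) \<longlonglongrightarrow> 0"
        using cons \<open>\<delta> > 0\<close> by (simp add: consistent_def)
      moreover have "(\<lambda>n. prob (?V n)) \<longlonglongrightarrow> 0"
        using \<open>\<sigma>2 > 0\<close> by (intro sq.prob_sum_ge_tendsto_0) (auto simp: \<sigma>2_def)
      ultimately have "\<forall>\<^sub>F n in sequentially. prob (?L n) < \<kappa> / 3 \<and> prob (?V n) < \<kappa> / 3 \<and> n \<ge> 1"
        using \<open>\<kappa> > 0\<close> by (intro eventually_conj order_tendstoD eventually_ge_at_top) auto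
      then have "\<forall>\<^sub>F n in sequentially. norm (prob (?T n) - 0) < \<kappa>"
      proof (rule eventually_mono)
        fix n
        assume "prob (?L n) < \<kappa> / 3 \<and> prob (?V n) < \<kappa> / 3 \<and> n \<ge> 1"
        then show "norm (prob (?T n) - 0) < \<kappa>"
          using bound[of n] by simp
      qed
      then show "\<exists>no. \<forall>n\<ge>no. norm (prob (?T n) - 0) < \<kappa>"
        by (simp add: eventually_sequentially)
    qed
  qed
qed

end

section \<open>Covariances of moving averages\<close>

lemma covariance_cong_AE:
  assumes "AE \<omega> in M. U \<omega> = U' \<omega>" "AE \<omega> in M. V \<omega> = V' \<omega>"
    and [measurable]: "U \<in> borel_measurable M" "U' \<in> borel_measurable M"
      "V \<in> borel_measurable M" "V' \<in> borel_measurable M"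
  shows "covariance M U V = covariance M U' V'"
proof -
  have "integral\<^sup>L M U = integral\<^sup>L M U'" "integral\<^sup>L M V = integral\<^sup>L M V'"
    using assms by (auto intro!: integral_cong_AE)
  moreover have "AE \<omega> in M. (U \<omega> - integral\<^sup>L M U') * (V \<omega> - integral\<^sup>L M V')
      = (U' \<omega> - integral\<^sup>L M U') * (V' \<omega> - integral\<^sup>L M V')"
    using assms(1,2) by eventually_elim simp
  ultimately show ?thesis
    unfolding covariance_def by (simp add: integral_cong_AE)
qed

text \<open>By independence of \<open>U\<close> and \<open>V0\<close>, the covariance with
  \<open>V\<close> equals that with \<open>W = V - V0\<close>. Each of its two terms, the mean of
  \<open>U * W\<close> and the product of the means, is at most \<open>G\<close> times the mean of
  \<open>|W|\<close>; this is the origin of the factor 2. Boundedness of \<open>U\<close> makes the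
  products integrable although \<open>V\<close> has only a first moment.\<close>

lemma (in prob_space) covariance_near_independent:
  assumes U [measurable]: "U \<in> borel_measurable M" and G: "\<And>\<omega>. \<omega> \<in> space M \<Longrightarrow> \<bar>U \<omega>\<bar> \<le> G"
    and V: "integrable M V" and V0: "integrable M V0" and ind: "indep_var borel U borel V0"
  shows "\<bar>covariance M U V\<bar> \<le> 2 * G * expectation (\<lambda>\<omega>. \<bar>V \<omega> - V0 \<omega>\<bar>)"
proof -
  have int_U: "integrable M U"
    using G by (intro integrable_const_bound[where B = G]) auto
  have int_UV: "integrable M (\<lambda>\<omega>. U \<omega> * W \<omega>)" if W: "integrable M W" for W
  proof (rule Bochner_Integration.integrable_bound)
    show "integrable M (\<lambda>\<omega>. G * W \<omega>)"
      using W by simp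
    show "AE \<omega> in M. norm (U \<omega> * W \<omega>) \<le> norm (G * W \<omega>)"
      using G by (intro AE_I2) (fastforce simp: abs_mult intro: mult_right_mono order_trans[OF _ abs_ge_self])
  qed (use W in simp)
  define W where "W = (\<lambda>\<omega>. V \<omega> - V0 \<omega>)"
  have int_W: "integrable M W"
    using V V0 by (simp add: W_def)
  have cov: "covariance M U V = expectation (\<lambda>\<omega>. U \<omega> * V \<omega>) - expectation U * expectation V"
  proof -
    have "covariance M U V = expectation (\<lambda>\<omega>. U \<omega> * V \<omega> - expectation V * U \<omega>
        - (expectation U * V \<omega> - expectation U * expectation V))"
      unfolding covariance_def by (intro Bochner_Integration.integral_cong) (auto simp: algebra_simps)
    also have "\<dots> = expectation (\<lambda>\<omega>. U \<omega> * V \<omega>) - expectation V * expectation U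
        - (expectation U * expectation V - expectation U * expectation V)"
      using int_U V int_UV[OF V] by (simp add: prob_space)
    finally show ?thesis
      by (simp add: mult.commute)
  qed
  have "expectation (\<lambda>\<omega>. U \<omega> * V \<omega>) = expectation (\<lambda>\<omega>. U \<omega> * W \<omega> + U \<omega> * V0 \<omega>)"
    by (simp add: W_def algebra_simps)
  also have "\<dots> = expectation (\<lambda>\<omega>. U \<omega> * W \<omega>) + expectation (\<lambda>\<omega>. U \<omega> * V0 \<omega>)"
    by (rule Bochner_Integration.integral_add[OF int_UV[OF int_W] int_UV[OF V0]])
  also have "expectation (\<lambda>\<omega>. U \<omega> * V0 \<omega>) = expectation U * expectation V0"
    by (rule indep_var_lebesgue_integral[OF ind int_U V0])
  also have "expectation V0 = expectation V - expectation W"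
    using V V0 by (simp add: W_def)
  finally have "covariance M U V = expectation (\<lambda>\<omega>. U \<omega> * W \<omega>) - expectation U * expectation W"
    unfolding cov by (simp add: algebra_simps)
  moreover have "\<bar>expectation (\<lambda>\<omega>. U \<omega> * W \<omega>)\<bar> \<le> G * expectation (\<lambda>\<omega>. \<bar>W \<omega>\<bar>)"
  proof -
    have "\<bar>expectation (\<lambda>\<omega>. U \<omega> * W \<omega>)\<bar> \<le> expectation (\<lambda>\<omega>. \<bar>U \<omega> * W \<omega>\<bar>)"
      by (rule integral_abs_bound)
    also have "\<dots> \<le> expectation (\<lambda>\<omega>. G * \<bar>W \<omega>\<bar>)"
    proof (rule integral_mono)
      show "integrable M (\<lambda>\<omega>. \<bar>U \<omega> * W \<omega>\<bar>)" "integrable M (\<lambda>\<omega>. G * \<bar>W \<omega>\<bar>)"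
        using int_UV[OF int_W] int_W by (simp_all only: integrable_abs integrable_mult_right)
    qed (use G in \<open>auto simp: abs_mult intro: mult_right_mono\<close>)
    finally show ?thesis
      by simp
  qed
  moreover have "\<bar>expectation U * expectation W\<bar> \<le> G * expectation (\<lambda>\<omega>. \<bar>W \<omega>\<bar>)"
  proof -
    have "\<bar>expectation U\<bar> \<le> expectation (\<lambda>\<omega>. \<bar>U \<omega>\<bar>)"
      by (rule integral_abs_bound)
    also have "\<dots> \<le> expectation (\<lambda>\<omega>. G)"
      using int_U G by (intro integral_mono) auto
    finally have "\<bar>expectation U\<bar> \<le> G"
      by (simp add: prob_space)
    then show ?thesis
      unfolding abs_mult by (intro mult_mono integral_abs_bound) auto
  qed
  ultimately show ?thesis
    by (simp add: W_def)
qed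

text \<open>The bound is a geometric series started at \<open>d\<close>. The tail is written with
  zeros in front instead of being shifted, so that it is a weight sequence for the same innovations
  at the same time indices.\<close>

lemma suminf_tail_le:
  fixes \<psi> :: "nat \<Rightarrow> real"
  assumes "\<And>j. \<bar>\<psi> j\<bar> \<le> C * r ^ j" "0 < r" "r < 1"
  shows "summable (\<lambda>j. \<bar>if d \<le> j then \<psi> j else 0\<bar>)"
    and "(\<Sum>j. \<bar>if d \<le> j then \<psi> j else 0\<bar>) \<le> C * r ^ d / (1 - r)"
proof -
  let ?f = "\<lambda>j. \<bar>if d \<le> j then \<psi> j else 0\<bar>"
  have "C \<ge> 0"
    using assms(1)[of 0] by simp
  show summable: "summable ?f"
  proof (rule summable_abs_of_geometric_bound)
    show "\<bar>if d \<le> j then \<psi> j else 0\<bar> \<le> C * r ^ j" for j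
      using assms(1)[of j] \<open>C \<ge> 0\<close> \<open>0 < r\<close> by auto
  qed fact+
  have "(\<Sum>j. ?f j) = (\<Sum>j. ?f (j + d)) + (\<Sum>j<d. ?f j)"
    by (rule suminf_split_initial_segment[OF summable])
  also have "(\<Sum>j<d. ?f j) = 0"
    by (intro sum.neutral) auto
  also have "(\<Sum>j. ?f (j + d)) \<le> (\<Sum>j. C * r ^ d * r ^ j)"
  proof (rule suminf_le)
    show "?f (j + d) \<le> C * r ^ d * r ^ j" for j
      using assms(1)[of "j + d"] by (simp add: power_add ac_simps)
    show "summable (\<lambda>j. ?f (j + d))"
      by (rule summable_ignore_initial_segment[OF summable])
    show "summable (\<lambda>j. C * r ^ d * r ^ j)"
      using assms by (intro summable_mult summable_geometric) simp
  qed
  also have "\<dots> = C * r ^ d / (1 - r)"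
    using assms by (simp add: suminf_mult summable_geometric suminf_geometric)
  finally show "(\<Sum>j. ?f j) \<le> C * r ^ d / (1 - r)"
    by simp
qed

lemma Lip_bound:
  assumes "Lip l h \<noteq> top" "x \<in> space (Rn l)" "y \<in> space (Rn l)"
  shows "\<bar>h x - h y\<bar> \<le> enn2real (Lip l h) * l1_dist l x y"
proof (cases "x = y")
  case False
  \<comment> \<open>Points of \<open>Rn l\<close> are \<open>undefined\<close> off
    \<open>{1..l}\<close>, so two different ones differ at a coordinate that \<open>l1_dist\<close>
    sees.\<close>
  then obtain i where "i \<in> {1..l}" "x i \<noteq> y i"
    using assms(2,3) by (auto simp: space_PiM PiE_iff extensional_def fun_eq_iff) metis
  then have pos: "l1_dist l x y > 0"
    unfolding l1_dist_def by (intro sum_pos2[of _ i]) auto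
  have "ennreal (\<bar>h x - h y\<bar> / l1_dist l x y) \<le> Lip l h"
    unfolding Lip_def using assms(2,3) False by (intro SUP_upper2[of "(x, y)"]) auto
  then have "\<bar>h x - h y\<bar> / l1_dist l x y \<le> enn2real (Lip l h)"
    using assms(1) pos by (metis enn2real_ennreal enn2real_mono divide_nonneg_pos abs_ge_zero top.not_eq_extremum)
  then show ?thesis
    using pos by (simp add: field_simps)
qed (simp add: l1_dist_def)

lemma sup_norm_bound:
  assumes "bounded (g ` space (Rn k))"
  shows "sup_norm k g \<noteq> top" and "x \<in> space (Rn k) \<Longrightarrow> \<bar>g x\<bar> \<le> enn2real (sup_norm k g)"
proof -
  obtain B where B: "\<And>x. x \<in> space (Rn k) \<Longrightarrow> \<bar>g x\<bar> \<le> B"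
    using assms by (auto simp: bounded_iff)
  then have "sup_norm k g \<le> ennreal B"
    unfolding sup_norm_def by (intro SUP_least ennreal_leI)
  then show fin: "sup_norm k g \<noteq> top"
    by (metis ennreal_neq_top neq_top_trans)
  assume "x \<in> space (Rn k)"
  then have "ennreal \<bar>g x\<bar> \<le> sup_norm k g"
    unfolding sup_norm_def by (rule SUP_upper)
  then show "\<bar>g x\<bar> \<le> enn2real (sup_norm k g)"
    using fin by (metis abs_ge_zero enn2real_ennreal enn2real_mono top.not_eq_extremum)
qed

context iid_sequence
begin

text \<open>Dropping the innovations up to time \<open>a\<close> from \<open>Y\<close> gives \<open>Y0\<close>, for which \<open>h (Y0)\<close> is
  independent of \<open>g (Y)\<close>; the cost of the replacement is a geometric tail. If \<open>Lip h = \<infinity>\<close> the claim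
  still says something when the last factor vanishes: then \<open>Y = Y0\<close> almost surely.\<close>

lemma covariance_linear_process_le:
  assumes psi: "\<And>j. \<bar>\<psi> j\<bar> \<le> C * r ^ j" "0 < r" "r < 1"
    and X: "\<And>t. AE \<omega> in M. X t \<omega> = (\<Sum>j. \<psi> j * \<epsilon> (t - int j) \<omega>)" "\<And>t. X t \<in> borel_measurable M"
    and S: "expectation (\<lambda>\<omega>. \<bar>\<epsilon> 0 \<omega>\<bar>) \<le> S"
    and s: "\<And>i. i \<in> {1..k} \<Longrightarrow> s i \<le> a" and t: "\<And>i. i \<in> {1..l} \<Longrightarrow> b \<le> t i" and "a \<le> b"
    and g [measurable]: "g \<in> borel_measurable (Rn k)" and h [measurable]: "h \<in> borel_measurable (Rn l)"
    and bdd: "bounded (g ` space (Rn k))"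
    and int_h: "integrable M (\<lambda>\<omega>. h (\<lambda>i\<in>{1..l}. X (t i) \<omega>))"
  shows "ennreal \<bar>covariance M (\<lambda>\<omega>. g (\<lambda>i\<in>{1..k}. X (s i) \<omega>)) (\<lambda>\<omega>. h (\<lambda>i\<in>{1..l}. X (t i) \<omega>))\<bar>
    \<le> sup_norm k g * Lip l h * ennreal (2 * real l * (C * r ^ nat (b - a) / (1 - r) * S))"
proof -
  note [measurable] = X(2)
  define Y where "Y = (\<lambda>t \<omega>. \<Sum>j. \<psi> j * \<epsilon> (t - int j) \<omega>)"
  define Y0 where "Y0 = (\<lambda>t \<omega>. \<Sum>j. if a < t - int j then \<psi> j * \<epsilon> (t - int j) \<omega> else 0)"
  have [measurable]: "Y t \<in> borel_measurable M" "Y0 t \<in> borel_measurable M" for t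
    by (simp_all add: Y_def Y0_def)
  define U where "U = (\<lambda>\<omega>. g (\<lambda>i\<in>{1..k}. Y (s i) \<omega>))"
  define V where "V = (\<lambda>\<omega>. h (\<lambda>i\<in>{1..l}. Y (t i) \<omega>))"
  define V0 where "V0 = (\<lambda>\<omega>. h (\<lambda>i\<in>{1..l}. Y0 (t i) \<omega>))"
  have [measurable]: "U \<in> borel_measurable M" "V \<in> borel_measurable M" "V0 \<in> borel_measurable M"
    "(\<lambda>\<omega>. g (\<lambda>i\<in>{1..k}. X (s i) \<omega>)) \<in> borel_measurable M"
    "(\<lambda>\<omega>. h (\<lambda>i\<in>{1..l}. X (t i) \<omega>)) \<in> borel_measurable M"
    unfolding U_def V_def V0_def by measurable
  define c where "c = C * r ^ nat (b - a) / (1 - r) * S"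
  have "C \<ge> 0"
    using psi(1)[of 0] by simp
  moreover have "0 \<le> expectation (\<lambda>\<omega>. \<bar>\<epsilon> 0 \<omega>\<bar>)"
    by (rule integral_nonneg_AE) simp
  then have "S \<ge> 0"
    using S by linarith
  ultimately have "c \<ge> 0"
    using psi by (simp add: c_def)

  have XY: "AE \<omega> in M. \<forall>t. X t \<omega> = Y t \<omega>"
    using X(1) by (subst AE_all_countable) (simp add: Y_def)
  have gU: "AE \<omega> in M. g (\<lambda>i\<in>{1..k}. X (s i) \<omega>) = U \<omega>"
    and hV: "AE \<omega> in M. h (\<lambda>i\<in>{1..l}. X (t i) \<omega>) = V \<omega>"
    unfolding U_def V_def using XY by (auto elim!: eventually_mono)
  then have cov: "covariance M (\<lambda>\<omega>. g (\<lambda>i\<in>{1..k}. X (s i) \<omega>)) (\<lambda>\<omega>. h (\<lambda>i\<in>{1..l}. X (t i) \<omega>))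
      = covariance M U V"
    by (rule covariance_cong_AE) measurable
  have int_V: "integrable M V"
    by (rule iffD1[OF integrable_cong_AE[OF _ _ hV] int_h]) measurable

  have ind: "indep_var borel U borel V0"
  proof -
    \<comment> \<open>\<open>U\<close> is a function of the innovations at times
      \<open>\<le> a\<close> alone and \<open>V0\<close> of those at times \<open>> a\<close>;
      independence comes from the disjointness of the two index sets.\<close>
    define F where "F = (\<lambda>e. g (\<lambda>i\<in>{1..k}. \<Sum>j. \<psi> j * e (s i - int j)))"
    define F0 where "F0 = (\<lambda>e. h (\<lambda>i\<in>{1..l}. \<Sum>j. if a < t i - int j then \<psi> j * e (t i - int j) else 0))"
    let ?PA = "PiM {..a} (\<lambda>_. borel) :: (int \<Rightarrow> real) measure"
    let ?PB = "PiM {a<..} (\<lambda>_. borel) :: (int \<Rightarrow> real) measure"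
    have "(\<lambda>e. e (s i - int j)) \<in> borel_measurable ?PA" if "i \<in> {1..k}" for i j
      using s[OF that] by (intro measurable_component_singleton) auto
    then have "F \<in> borel_measurable ?PA"
      unfolding F_def
      by (intro measurable_compose[OF measurable_restrict g] borel_measurable_suminf
          borel_measurable_times borel_measurable_const)
    moreover have "(\<lambda>e. if a < u then x * e u else 0) \<in> borel_measurable ?PB" for u x
      by (cases "a < u") (auto intro!: borel_measurable_times measurable_component_singleton)
    then have "F0 \<in> borel_measurable ?PB"
      unfolding F0_def
      by (intro measurable_compose[OF measurable_restrict h] borel_measurable_suminf)
    ultimately have "indep_var borel (F \<circ> (\<lambda>\<omega>. restrict (\<lambda>i. \<epsilon> i \<omega>) {..a}))
        borel (F0 \<circ> (\<lambda>\<omega>. restrict (\<lambda>i. \<epsilon> i \<omega>) {a<..}))"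
      by (intro indep_var_compose[OF indep_var_restrict[OF indep]]) auto
    moreover have "F \<circ> (\<lambda>\<omega>. restrict (\<lambda>i. \<epsilon> i \<omega>) {..a}) = U"
    proof
      fix \<omega>
      have "s i - int j \<le> a" if "i \<in> {1..k}" for i j
        using s[OF that] by simp
      then have "(\<lambda>i\<in>{1..k}. \<Sum>j. \<psi> j * restrict (\<lambda>i. \<epsilon> i \<omega>) {..a} (s i - int j))
          = (\<lambda>i\<in>{1..k}. Y (s i) \<omega>)"
        unfolding Y_def by (intro restrict_ext) simp
      then show "(F \<circ> (\<lambda>\<omega>. restrict (\<lambda>i. \<epsilon> i \<omega>) {..a})) \<omega> = U \<omega>"
        by (simp only: F_def U_def comp_def)
    qed
    moreover have "F0 \<circ> (\<lambda>\<omega>. restrict (\<lambda>i. \<epsilon> i \<omega>) {a<..}) = V0"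
    proof
      fix \<omega>
      have "(\<lambda>i\<in>{1..l}. \<Sum>j. if a < t i - int j then \<psi> j * restrict (\<lambda>i. \<epsilon> i \<omega>) {a<..} (t i - int j) else 0)
          = (\<lambda>i\<in>{1..l}. Y0 (t i) \<omega>)"
        unfolding Y0_def by (intro restrict_ext suminf_cong) simp
      then show "(F0 \<circ> (\<lambda>\<omega>. restrict (\<lambda>i. \<epsilon> i \<omega>) {a<..})) \<omega> = V0 \<omega>"
        by (simp only: F0_def V0_def comp_def)
    qed
    ultimately show ?thesis
      by simp
  qed

  define D where "D = (\<lambda>\<omega>. \<Sum>i=1..l. \<bar>Y (t i) \<omega> - Y0 (t i) \<omega>\<bar>)"
  have [measurable]: "D \<in> borel_measurable M"
    by (simp add: D_def)
  have "(\<integral>\<^sup>+\<omega>. ennreal \<bar>Y u \<omega> - Y0 u \<omega>\<bar> \<partial>M) \<le> ennreal c" if "b \<le> u" for u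
  proof -
    \<comment> \<open>The condition \<open>a < u - int j\<close> fails exactly for
      \<open>j \<ge> u - a\<close>, so the removed part is a tail starting at \<open>?d\<close>;
      \<open>u - a\<close> is nonnegative because \<open>a \<le> b \<le> u\<close>.\<close>
    let ?d = "nat (u - a)"
    let ?\<psi>' = "\<lambda>j. if ?d \<le> j then \<psi> j else 0"
    have "AE \<omega> in M. Y u \<omega> - Y0 u \<omega> = (\<Sum>j. ?\<psi>' j * \<epsilon> (u - int j) \<omega>)"
      using AE_summable_noise[OF summable_abs_of_geometric_bound[OF psi]]
    proof eventually_elim
      case (elim \<omega>)
      then have abs: "summable (\<lambda>j. \<bar>\<psi> j * \<epsilon> (u - int j) \<omega>\<bar>)"
        by blast
      then have "summable (\<lambda>j. if a < u - int j then \<psi> j * \<epsilon> (u - int j) \<omega> else 0)"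
        by (rule summable_comparison_test[rotated]) auto
      then have "Y u \<omega> - Y0 u \<omega> = (\<Sum>j. \<psi> j * \<epsilon> (u - int j) \<omega>
          - (if a < u - int j then \<psi> j * \<epsilon> (u - int j) \<omega> else 0))"
        unfolding Y_def Y0_def by (rule suminf_diff[OF summable_rabs_cancel[OF abs]])
      also have "\<dots> = (\<Sum>j. ?\<psi>' j * \<epsilon> (u - int j) \<omega>)"
        using \<open>a \<le> b\<close> that by (intro suminf_cong) auto
      finally show ?case .
    qed
    then have "(\<integral>\<^sup>+\<omega>. ennreal \<bar>Y u \<omega> - Y0 u \<omega>\<bar> \<partial>M)
        = (\<integral>\<^sup>+\<omega>. ennreal \<bar>\<Sum>j. ?\<psi>' j * \<epsilon> (u - int j) \<omega>\<bar> \<partial>M)"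
      by (intro nn_integral_cong_AE) auto
    also have "\<dots> \<le> ennreal ((\<Sum>j. \<bar>?\<psi>' j\<bar>) * expectation (\<lambda>\<omega>. \<bar>\<epsilon> 0 \<omega>\<bar>))"
      by (rule nn_integral_abs_linear_process_le[OF suminf_tail_le(1)[OF psi]])
    also have "\<dots> \<le> ennreal c"
    proof (rule ennreal_leI)
      have "r ^ ?d \<le> r ^ nat (b - a)"
        using that psi by (intro power_decreasing) auto
      then have "C * r ^ ?d / (1 - r) \<le> C * r ^ nat (b - a) / (1 - r)"
        using psi \<open>C \<ge> 0\<close> by (intro divide_right_mono mult_left_mono) auto
      then have "(\<Sum>j. \<bar>?\<psi>' j\<bar>) \<le> C * r ^ nat (b - a) / (1 - r)"
        using suminf_tail_le(2)[OF psi, of ?d] by linarith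
      then show "(\<Sum>j. \<bar>?\<psi>' j\<bar>) * expectation (\<lambda>\<omega>. \<bar>\<epsilon> 0 \<omega>\<bar>) \<le> c"
        unfolding c_def using S psi \<open>C \<ge> 0\<close> by (intro mult_mono) auto
    qed
    finally show ?thesis .
  qed
  then have "(\<integral>\<^sup>+\<omega>. ennreal (D \<omega>) \<partial>M) \<le> (\<Sum>i=1..l. ennreal c)"
    using t unfolding D_def by (simp add: sum_ennreal[symmetric] nn_integral_sum del: sum_ennreal sum_constant)
      (intro sum_mono; simp)
  also have "\<dots> = ennreal (real l * c)"
    using \<open>c \<ge> 0\<close> by (simp add: ennreal_mult ennreal_of_nat_eq_real_of_nat)
  finally have nn_D: "(\<integral>\<^sup>+\<omega>. ennreal (D \<omega>) \<partial>M) \<le> ennreal (real l * c)" .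
  have D_nonneg: "0 \<le> D \<omega>" for \<omega>
    by (simp add: D_def sum_nonneg)
  have int_D: "integrable M D"
    using nn_D D_nonneg by (intro integrableI_bounded) (auto simp: le_less_trans[OF _ ennreal_less_top])
  have E_D: "expectation D \<le> real l * c"
    using nn_D int_D D_nonneg \<open>c \<ge> 0\<close> by (simp add: nn_integral_eq_integral)

  define G where "G = enn2real (sup_norm k g)"
  have G: "\<bar>U \<omega>\<bar> \<le> G" for \<omega>
    unfolding U_def G_def by (rule sup_norm_bound(2)[OF bdd]) (auto simp: space_PiM)
  have sup: "sup_norm k g = ennreal G"
    using sup_norm_bound(1)[OF bdd] by (simp add: G_def ennreal_enn2real_if)
  have "G \<ge> 0"
    by (simp add: G_def)
  \<comment> \<open>\<open>L\<close> is left open: it will be the Lipschitz constant when that is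
    finite, and 0 when \<open>D\<close> vanishes almost surely. Integrability of \<open>V0\<close>
    follows from that of \<open>V\<close>, since the difference is dominated by
    \<open>L * D\<close>.\<close>
  have near: "\<bar>covariance M U V\<bar> \<le> 2 * G * L * (real l * c)"
    if "L \<ge> 0" and le: "AE \<omega> in M. \<bar>V \<omega> - V0 \<omega>\<bar> \<le> L * D \<omega>" for L
  proof -
    have "integrable M (\<lambda>\<omega>. V \<omega> - V0 \<omega>)"
    proof (rule Bochner_Integration.integrable_bound)
      show "integrable M (\<lambda>\<omega>. L * D \<omega>)"
        using int_D by simp
      show "AE \<omega> in M. norm (V \<omega> - V0 \<omega>) \<le> norm (L * D \<omega>)"
        using le by eventually_elim auto
    qed measurable
    from Bochner_Integration.integrable_diff[OF int_V this] have int_V0: "integrable M V0"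
      by simp
    have "expectation (\<lambda>\<omega>. \<bar>V \<omega> - V0 \<omega>\<bar>) \<le> expectation (\<lambda>\<omega>. L * D \<omega>)"
      using le int_D int_V int_V0 by (intro integral_mono_AE) auto
    also have "\<dots> \<le> L * (real l * c)"
      using E_D \<open>L \<ge> 0\<close> by (simp add: mult_left_mono)
    finally have "2 * G * expectation (\<lambda>\<omega>. \<bar>V \<omega> - V0 \<omega>\<bar>) \<le> 2 * G * (L * (real l * c))"
      using \<open>G \<ge> 0\<close> by (intro mult_left_mono) auto
    moreover have "\<bar>covariance M U V\<bar> \<le> 2 * G * expectation (\<lambda>\<omega>. \<bar>V \<omega> - V0 \<omega>\<bar>)"
      using int_V int_V0 ind G by (intro covariance_near_independent) auto
    ultimately show ?thesis
      by (simp add: mult.assoc)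
  qed
  have "ennreal \<bar>covariance M U V\<bar> \<le> sup_norm k g * Lip l h * ennreal (2 * real l * c)"
  proof (cases "Lip l h = top")
    case False
    define L where "L = enn2real (Lip l h)"
    have L: "Lip l h = ennreal L" "L \<ge> 0"
      using False by (simp_all add: L_def ennreal_enn2real_if)
    have "\<bar>V \<omega> - V0 \<omega>\<bar> \<le> L * D \<omega>" for \<omega>
      using Lip_bound[OF False, of "\<lambda>i\<in>{1..l}. Y (t i) \<omega>" "\<lambda>i\<in>{1..l}. Y0 (t i) \<omega>"]
      by (simp add: V_def V0_def D_def L_def l1_dist_def space_PiM)
    then have "\<bar>covariance M U V\<bar> \<le> G * L * (2 * real l * c)"
      using near[of L] L(2) by (simp add: ac_simps)
    then have "ennreal \<bar>covariance M U V\<bar> \<le> ennreal (G * L * (2 * real l * c))"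
      by (rule ennreal_leI)
    also have "\<dots> = sup_norm k g * Lip l h * ennreal (2 * real l * c)"
      using \<open>G \<ge> 0\<close> \<open>L \<ge> 0\<close> \<open>c \<ge> 0\<close> by (simp only: sup L ennreal_mult mult_nonneg_nonneg of_nat_0_le_iff zero_le_numeral)
    finally show ?thesis .
  next
    case True
    \<comment> \<open>Since \<open>0 * top = 0\<close> in \<open>ennreal\<close>, the right-hand
      side is \<open>top\<close> unless one of the other factors is 0. Each such zero must therefore
      make the covariance vanish.\<close>
    consider "G = 0" | "real l * c = 0" | "G > 0" "real l * c > 0"
      using \<open>G \<ge> 0\<close> \<open>c \<ge> 0\<close> by (metis less_eq_real_def mult_nonneg_nonneg of_nat_0_le_iff)
    then show ?thesis
    proof cases
      case 1
      then have "U = (\<lambda>\<omega>. 0)"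
        using G by auto
      then have "covariance M U V = 0"
        by (simp add: covariance_def)
      then show ?thesis
        by simp
    next
      case 2
      then have "expectation D = 0"
        using E_D D_nonneg by (intro antisym integral_nonneg_AE) auto
      then have "AE \<omega> in M. D \<omega> = 0"
        using integral_nonneg_eq_0_iff_AE[OF int_D] D_nonneg by simp
      then have "AE \<omega> in M. \<bar>V \<omega> - V0 \<omega>\<bar> \<le> 0 * D \<omega>"
      proof eventually_elim
        case (elim \<omega>)
        then have "\<forall>i\<in>{1..l}. \<bar>Y (t i) \<omega> - Y0 (t i) \<omega>\<bar> = 0"
          unfolding D_def by (subst (asm) sum_nonneg_eq_0_iff) auto
        then have "(\<lambda>i\<in>{1..l}. Y (t i) \<omega>) = (\<lambda>i\<in>{1..l}. Y0 (t i) \<omega>)"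
          by (intro restrict_ext) auto
        then show ?case
          by (simp add: V_def V0_def)
      qed
      then show ?thesis
        using near[of 0] by simp
    next
      case 3
      then have "l > 0" "c > 0"
        by (auto simp: zero_less_mult_iff)
      with 3(1) have "sup_norm k g * Lip l h * ennreal (2 * real l * c) = top"
        by (simp add: sup True ennreal_mult_top ennreal_top_mult ennreal_mult_eq_top_iff)
      then show ?thesis
        by simp
    qed
  qed
  then show ?thesis
    by (simp only: cov c_def)
qed

end

section \<open>The bootstrap process\<close>

lemma measurable_id_data_algebra:
  assumes "\<And>t. X t \<in> borel_measurable M"
  shows "(\<lambda>\<omega>. \<omega>) \<in> M \<rightarrow>\<^sub>M data_algebra M X p n"
  unfolding data_algebra_def
  by (rule measurable_vimage_algebra2) (auto intro!: measurable_restrict assms)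

lemma measurable_observation:
  assumes "t \<in> {1 - int p..int n}"
  shows "(\<lambda>\<omega>. X t \<omega>) \<in> borel_measurable (data_algebra M X p n)"
proof -
  have "(\<lambda>\<omega>. \<lambda>t\<in>{1 - int p..int n}. X t \<omega>)
      \<in> data_algebra M X p n \<rightarrow>\<^sub>M PiM {1 - int p..int n} (\<lambda>_. borel)"
    unfolding data_algebra_def by (rule measurable_vimage_algebra1) (auto simp: space_PiM)
  from measurable_compose[OF this measurable_component_singleton[OF assms]]
  show ?thesis
    using assms by simp
qed

lemma measurable_centred_residual:
  assumes "\<And>j. j \<in> {1..p} \<Longrightarrow> (\<lambda>\<omega>. \<theta>h \<omega> j) \<in> borel_measurable (data_algebra M X p n)"
    and "t \<in> {1..int n}"
  shows "(\<lambda>\<omega>. centred_residual p (\<theta>h \<omega>) (\<lambda>t. X t \<omega>) n t) \<in> borel_measurable (data_algebra M X p n)"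
proof -
  have "(\<lambda>\<omega>. residual p (\<theta>h \<omega>) (\<lambda>t. X t \<omega>) u) \<in> borel_measurable (data_algebra M X p n)"
    if "u \<in> {1..int n}" for u
    unfolding residual_def ar_pred_def using assms(1) that
    by (intro borel_measurable_diff borel_measurable_sum borel_measurable_times measurable_observation)
      auto
  then show ?thesis
    unfolding centred_residual_def using assms(2)
    by (intro borel_measurable_diff borel_measurable_times borel_measurable_sum borel_measurable_const)
      auto
qed

text \<open>Under the empirical law the first absolute moment is an average over the centred
  residuals. Cauchy-Schwarz bounds it by their root mean square, which is at most
  \<open>sqrt (8 * V)\<close>, and \<open>sqrt 8 < 3\<close>.\<close>

lemma bootstrap_innovations:
  assumes boot: "bootstrap_process N p \<theta> x n \<epsilon>s Xs" and "n \<ge> 1" "V \<ge> 0"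
    and var: "(\<Sum>t=1..int n. (centred_residual p \<theta> x n t)\<^sup>2) \<le> 8 * V * real n"
  shows "iid_sequence N \<epsilon>s" and "(\<integral>\<omega>. \<bar>\<epsilon>s 0 \<omega>\<bar> \<partial>N) \<le> 3 * sqrt V"
proof -
  let ?c = "centred_residual p \<theta> x n"
  let ?u = "uniform_count_measure {1..int n}"
  interpret prob_space N
    using boot by (simp add: bootstrap_process_def)
  have iid: "iid N \<epsilon>s" and law: "distr N borel (\<epsilon>s 0) = distr ?u borel ?c"
    using boot by (simp_all add: bootstrap_process_def residual_distribution_def)
  have [measurable]: "\<epsilon>s 0 \<in> borel_measurable N"
    using iid by (simp add: iid_def indep_vars_def)
  have c [measurable]: "?c \<in> borel_measurable ?u"
    by (simp add: measurable_cong_sets[OF sets_uniform_count_measure_count_space refl])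
  have "integrable ?u ?c"
    unfolding uniform_count_measure_def by (rule integrable_point_measure_finite) simp
  then have "integrable (distr N borel (\<epsilon>s 0)) (\<lambda>y. y)"
    unfolding law using c by (simp add: integrable_distr_eq)
  then have "integrable N (\<epsilon>s 0)"
    by (simp add: integrable_distr_eq)
  then show "iid_sequence N \<epsilon>s"
    using iid by unfold_locales
  have "(\<integral>\<omega>. \<bar>\<epsilon>s 0 \<omega>\<bar> \<partial>N) = (\<integral>y. \<bar>y\<bar> \<partial>distr N borel (\<epsilon>s 0))"
    by (rule integral_distr[symmetric]) auto
  also have "\<dots> = (\<integral>t. \<bar>?c t\<bar> \<partial>?u)"
    unfolding law by (rule integral_distr[OF c]) simp
  also have "\<dots> = (\<Sum>t=1..int n. \<bar>?c t\<bar>) / real n"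
    by (simp add: integral_uniform_count_measure)
  also have "\<dots> \<le> 3 * sqrt V"
  proof -
    have "(\<Sum>t=1..int n. 1 * \<bar>?c t\<bar>)\<^sup>2 \<le> (\<Sum>t=1..int n. 1\<^sup>2) * (\<Sum>t=1..int n. \<bar>?c t\<bar>\<^sup>2)"
      by (rule Cauchy_Schwarz_ineq_sum)
    then have "(\<Sum>t=1..int n. \<bar>?c t\<bar>)\<^sup>2 \<le> real n * (\<Sum>t=1..int n. (?c t)\<^sup>2)"
      by simp
    also have "\<dots> \<le> real n * (8 * V * real n)"
      using var by (intro mult_left_mono) auto
    also have "\<dots> \<le> (3 * sqrt V * real n)\<^sup>2"
    proof -
      have "(3 * sqrt V * real n)\<^sup>2 = 9 * V * (real n)\<^sup>2"
        using \<open>V \<ge> 0\<close> by (simp add: power_mult_distrib)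
      moreover have "real n * (8 * V * real n) = 8 * V * (real n)\<^sup>2"
        by (simp add: power2_eq_square)
      moreover have "8 * V * (real n)\<^sup>2 \<le> 9 * V * (real n)\<^sup>2"
        using \<open>V \<ge> 0\<close> by (intro mult_right_mono) auto
      ultimately show ?thesis
        by linarith
    qed
    finally have "(\<Sum>t=1..int n. \<bar>?c t\<bar>) \<le> 3 * sqrt V * real n"
      by (rule power2_le_imp_le) (use \<open>V \<ge> 0\<close> in simp)
    then show ?thesis
      using \<open>n \<ge> 1\<close> by (simp add: field_simps)
  qed
  finally show "(\<integral>\<omega>. \<bar>\<epsilon>s 0 \<omega>\<bar> \<partial>N) \<le> 3 * sqrt V" .
qed

section \<open>Choice of the rate, the constant and the favourable events\<close>

theorem corollary2p2:
  fixes M :: "'a measure" and p :: nat and \<theta> :: "nat \<Rightarrow> real"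
    and \<epsilon> X :: "int \<Rightarrow> 'a \<Rightarrow> real"
    and \<theta>h :: "nat \<Rightarrow> 'a \<Rightarrow> nat \<Rightarrow> real"
    and N :: "nat \<Rightarrow> 'a \<Rightarrow> 'b measure"
    and \<epsilon>s Xs :: "nat \<Rightarrow> 'a \<Rightarrow> int \<Rightarrow> 'b \<Rightarrow> real"
    and \<eta> :: real
  assumes "prob_space M"
    and "iid M \<epsilon>"
    and "integrable M (\<epsilon> 0)" and "integral\<^sup>L M (\<epsilon> 0) = 0"
    and "integrable M (\<lambda>\<omega>. (\<epsilon> 0 \<omega>)\<^sup>2)"
    and "\<exists>j\<in>{1..p}. \<theta> j \<noteq> 0"
    and "\<forall>z. cmod z \<le> 1 \<longrightarrow> poly (ar_poly p \<theta>) z \<noteq> 0"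
    and "ar_solution M p \<theta> \<epsilon> X" and "stationary M X"
    and "\<forall>n\<ge>1. \<forall>j\<in>{1..p}. (\<lambda>\<omega>. \<theta>h n \<omega> j) \<in> borel_measurable (data_algebra M X p n)"
    and "consistent M p \<theta>h \<theta>"
    and "\<forall>n\<ge>1. \<forall>\<omega>\<in>space M.
           bootstrap_process (N n \<omega>) p (\<theta>h n \<omega>) (\<lambda>t. X t \<omega>) n (\<epsilon>s n \<omega>) (Xs n \<omega>)"
    and "\<forall>n\<ge>1. \<forall>\<omega>\<in>space M. stationary_regime (N n \<omega>) p (\<theta>h n \<omega>) (\<epsilon>s n \<omega>) (Xs n \<omega>)"
    and "\<eta> > 0"
  shows "\<exists>(K :: real) (\<Omega> :: nat \<Rightarrow> 'a set).
    (\<forall>n\<ge>1. \<Omega> n \<in> sets (data_algebra M X p n)) \<and>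
    (\<lambda>n. measure M (\<Omega> n)) \<longlonglongrightarrow> 1 \<and>
    (\<forall>n\<ge>1. \<forall>\<omega>\<in>\<Omega> n.
      \<forall>(k :: nat) (l :: nat) (s :: nat \<Rightarrow> int) (t :: nat \<Rightarrow> int)
        (g :: (nat \<Rightarrow> real) \<Rightarrow> real) (h :: (nat \<Rightarrow> real) \<Rightarrow> real).
        k \<ge> 1 \<longrightarrow> l \<ge> 1 \<longrightarrow>
        mono_on {1..k} s \<longrightarrow> s k \<le> t 1 \<longrightarrow> mono_on {1..l} t \<longrightarrow>
        g \<in> borel_measurable (Rn k) \<longrightarrow> h \<in> borel_measurable (Rn l) \<longrightarrow>
        bounded (g ` space (Rn k)) \<longrightarrow>
        integrable (N n \<omega>) (\<lambda>\<omega>'. h (\<lambda>i\<in>{1..l}. Xs n \<omega> (t i) \<omega>')) \<longrightarrow>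
        ennreal \<bar>covariance (N n \<omega>)
            (\<lambda>\<omega>'. g (\<lambda>i\<in>{1..k}. Xs n \<omega> (s i) \<omega>'))
            (\<lambda>\<omega>'. h (\<lambda>i\<in>{1..l}. Xs n \<omega> (t i) \<omega>'))\<bar>
          \<le> sup_norm k g * Lip l h *
            ennreal (2 * K * sqrt (integral\<^sup>L M (\<lambda>\<omega>. (\<epsilon> 0 \<omega>)\<^sup>2)) * real l *
              ((1 + \<eta>) / min_root_modulus p \<theta>) powi (t 1 - s k)))"
proof -
  interpret M: prob_space M
    by (rule assms(1))
  interpret M: iid_sequence M \<epsilon>
    by unfold_locales (use assms in auto)
  define \<rho> where "\<rho> = min_root_modulus p \<theta>"
  define \<sigma>2 where "\<sigma>2 = integral\<^sup>L M (\<lambda>\<omega>. (\<epsilon> 0 \<omega>)\<^sup>2)"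
  have "\<sigma>2 \<ge> 0"
    by (simp add: \<sigma>2_def)
  have X_meas: "X t \<in> borel_measurable M" for t
    using assms(8) by (simp add: ar_solution_def)
  have "\<rho> > 1"
    unfolding \<rho>_def using assms(6,7) by (rule min_root_modulus_gt_1)

  \<comment> \<open>Above \<open>1 / \<rho>\<close>, so that the disc of radius \<open>1 / r\<close>
    avoids the zeros; at most the required rate; and, through the midpoint of
    \<open>1 / \<rho>\<close> and 1, below 1 even for large \<open>\<eta>\<close>.\<close>
  define r where "r = min ((1 + \<eta>) / \<rho>) ((1 + 1 / \<rho>) / 2)"
  have "1 / \<rho> < r"
    using \<open>\<rho> > 1\<close> \<open>\<eta> > 0\<close> by (simp add: r_def field_simps)
  moreover have "1 / \<rho> > 0"
    using \<open>\<rho> > 1\<close> by simp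
  ultimately have "0 < r"
    by linarith
  have "(1 + 1 / \<rho>) / 2 < 1"
    using \<open>\<rho> > 1\<close> by (simp add: field_simps)
  then have "r < 1"
    unfolding r_def by (rule min.strict_coboundedI2)
  have "1 / r < \<rho>"
    using \<open>1 / \<rho> < r\<close> \<open>0 < r\<close> \<open>\<rho> > 1\<close> by (simp add: field_simps)
  obtain C \<delta> where C: "C > 0" "\<delta> > 0"
    "\<And>\<theta>' j. l1_dist p \<theta>' \<theta> \<le> \<delta> \<Longrightarrow> \<bar>ma_coeff p \<theta>' j\<bar> \<le> C * r ^ j"
  proof (rule ma_coeff_geometric_bound_near[of "1 / r" p \<theta>])
    show "\<forall>z. cmod z \<le> 1 / r \<longrightarrow> poly (ar_poly p \<theta>) z \<noteq> 0"
      using \<open>1 / r < \<rho>\<close> ar_poly_nonzero_below_min_root unfolding \<rho>_def by fastforce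
  qed (use \<open>0 < r\<close> in auto)
  have psi: "\<bar>ma_coeff p \<theta> j\<bar> \<le> C * r ^ j" for j
    using C(2,3) by (simp add: l1_dist_def)

  \<comment> \<open>The 3 comes from the first moment of the bootstrap innovations,
    \<open>C / (1 - r)\<close> from the geometric tail of the weights.\<close>
  define K where "K = 3 * C / (1 - r)"
  \<comment> \<open>Both conditions involve the sample only through the estimate and the centred
    residuals, which makes the event measurable with respect to the data.\<close>
  define \<Omega> where "\<Omega> = (\<lambda>n. {\<omega> \<in> space M. l1_dist p (\<theta>h n \<omega>) \<theta> \<le> \<delta> \<and>
    (\<Sum>t=1..int n. (centred_residual p (\<theta>h n \<omega>) (\<lambda>t. X t \<omega>) n t)\<^sup>2) \<le> 8 * \<sigma>2 * real n})"
  have \<Omega>_sets: "\<Omega> n \<in> sets (data_algebra M X p n)" if "n \<ge> 1" for n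
  proof -
    have \<theta>h: "\<And>j. j \<in> {1..p} \<Longrightarrow> (\<lambda>\<omega>. \<theta>h n \<omega> j) \<in> borel_measurable (data_algebra M X p n)"
      using assms(10) that by blast
    have [measurable]: "(\<lambda>\<omega>. l1_dist p (\<theta>h n \<omega>) \<theta>) \<in> borel_measurable (data_algebra M X p n)"
      unfolding l1_dist_def using \<theta>h
      by (intro borel_measurable_sum borel_measurable_abs borel_measurable_diff borel_measurable_const)
    have [measurable]: "(\<lambda>\<omega>. \<Sum>t=1..int n. (centred_residual p (\<theta>h n \<omega>) (\<lambda>t. X t \<omega>) n t)\<^sup>2)
        \<in> borel_measurable (data_algebra M X p n)"
      by (intro borel_measurable_sum borel_measurable_power measurable_centred_residual \<theta>h)
    have "space M = space (data_algebra M X p n)"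
      by (simp add: data_algebra_def)
    then show ?thesis
      unfolding \<Omega>_def by simp
  qed
  have subalg: "\<Omega> n \<in> sets M" if "n \<ge> 1" for n
  proof -
    have "\<Omega> n \<subseteq> space M"
      unfolding \<Omega>_def by blast
    then have "(\<lambda>\<omega>. \<omega>) -` \<Omega> n \<inter> space M = \<Omega> n"
      by blast
    then show ?thesis
      using measurable_sets[OF measurable_id_data_algebra[of X M p n, OF X_meas] \<Omega>_sets[OF that]] by metis
  qed
  have \<theta>h_meas: "(\<lambda>\<omega>. \<theta>h n \<omega> j) \<in> borel_measurable M" if "n \<ge> 1" "j \<in> {1..p}" for n j
    by (rule measurable_compose[OF measurable_id_data_algebra[of X M p n, OF X_meas]])
      (use assms(10) that in blast)
  have \<Omega>_prob: "(\<lambda>n. measure M (\<Omega> n)) \<longlonglongrightarrow> 1"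
  proof (rule tendsto_sandwich)
    let ?L = "\<lambda>n. {\<omega> \<in> space M. l1_dist p (\<theta>h n \<omega>) \<theta> > \<delta>}"
    let ?T = "\<lambda>n. {\<omega> \<in> space M. 8 * \<sigma>2 * real n
      < (\<Sum>t=1..int n. (residual p (\<theta>h n \<omega>) (\<lambda>t. X t \<omega>) t)\<^sup>2)}"
    have "(\<lambda>n. M.prob (?L n)) \<longlonglongrightarrow> 0"
      using assms(11) C(2) by (simp add: consistent_def)
    moreover have "(\<lambda>n. M.prob (?T n)) \<longlonglongrightarrow> 0"
      unfolding \<sigma>2_def
      by (rule M.prob_residual_variance_tendsto_0[OF assms(8,9) psi \<open>0 < r\<close> \<open>r < 1\<close> assms(5,11) \<theta>h_meas])
    ultimately have "(\<lambda>n. 1 - (M.prob (?L n) + M.prob (?T n))) \<longlonglongrightarrow> 1 - (0 + 0)"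
      by (intro tendsto_intros)
    then show "(\<lambda>n. 1 - (M.prob (?L n) + M.prob (?T n))) \<longlonglongrightarrow> 1"
      by simp
    show "\<forall>\<^sub>F n in sequentially. 1 - (M.prob (?L n) + M.prob (?T n)) \<le> M.prob (\<Omega> n)"
      using eventually_ge_at_top[of 1]
    proof eventually_elim
      case (elim n)
      have [measurable]: "(\<lambda>\<omega>. l1_dist p (\<theta>h n \<omega>) \<theta>) \<in> borel_measurable M"
        unfolding l1_dist_def using \<theta>h_meas[OF elim]
        by (intro borel_measurable_sum borel_measurable_abs borel_measurable_diff borel_measurable_const)
      have [measurable]: "(\<lambda>\<omega>. residual p (\<theta>h n \<omega>) (\<lambda>t. X t \<omega>) t) \<in> borel_measurable M" for t
        unfolding residual_def ar_pred_def using \<theta>h_meas[OF elim] X_meas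
        by (intro borel_measurable_diff borel_measurable_sum borel_measurable_times)
      have L: "?L n \<in> sets M" and T: "?T n \<in> sets M"
        by measurable
      have "space M - \<Omega> n \<subseteq> ?L n \<union> ?T n"
      proof
        fix \<omega>
        assume "\<omega> \<in> space M - \<Omega> n"
        then show "\<omega> \<in> ?L n \<union> ?T n"
          using sum_centred_residual_square_le[of p "\<theta>h n \<omega>" "\<lambda>t. X t \<omega>" n]
          by (auto simp: \<Omega>_def)
      qed
      then have "M.prob (space M - \<Omega> n) \<le> M.prob (?L n \<union> ?T n)"
        using L T by (intro M.finite_measure_mono) auto
      also have "\<dots> \<le> M.prob (?L n) + M.prob (?T n)"
        using L T by (rule measure_Un_le)
      finally show ?case
        using M.prob_compl[OF subalg[OF elim]] by linarith
    qed
  qed (auto intro: tendsto_const)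

  show ?thesis
  proof (intro exI[of _ K] exI[of _ \<Omega>] conjI allI impI ballI)
    show "\<Omega> n \<in> sets (data_algebra M X p n)" if "n \<ge> 1" for n
      using that by (rule \<Omega>_sets)
    show "(\<lambda>n. measure M (\<Omega> n)) \<longlonglongrightarrow> 1"
      by (rule \<Omega>_prob)
    fix n \<omega> and k l :: nat and s t :: "nat \<Rightarrow> int" and g h :: "(nat \<Rightarrow> real) \<Rightarrow> real"
    assume n: "n \<ge> 1" and \<omega>: "\<omega> \<in> \<Omega> n" and kl: "k \<ge> 1" "l \<ge> 1"
      and s: "mono_on {1..k} s" and st: "s k \<le> t 1" and t: "mono_on {1..l} t"
      and g: "g \<in> borel_measurable (Rn k)" and h: "h \<in> borel_measurable (Rn l)"
      and bdd: "bounded (g ` space (Rn k))"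
      and int_h: "integrable (N n \<omega>) (\<lambda>\<omega>'. h (\<lambda>i\<in>{1..l}. Xs n \<omega> (t i) \<omega>'))"
    let ?N = "N n \<omega>" and ?\<theta> = "\<theta>h n \<omega>" and ?\<epsilon> = "\<epsilon>s n \<omega>" and ?X = "Xs n \<omega>"
    have \<omega>M: "\<omega> \<in> space M" and near: "l1_dist p ?\<theta> \<theta> \<le> \<delta>"
      and var: "(\<Sum>t=1..int n. (centred_residual p ?\<theta> (\<lambda>t. X t \<omega>) n t)\<^sup>2) \<le> 8 * \<sigma>2 * real n"
      using \<omega> by (auto simp: \<Omega>_def)
    have boot: "bootstrap_process ?N p ?\<theta> (\<lambda>t. X t \<omega>) n ?\<epsilon> ?X"
      using assms(12) n \<omega>M by blast
    interpret B: iid_sequence ?N ?\<epsilon>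
      by (rule bootstrap_innovations(1)[OF boot n \<open>\<sigma>2 \<ge> 0\<close> var])
    note first_moment = bootstrap_innovations(2)[OF boot n \<open>\<sigma>2 \<ge> 0\<close> var]
    note psi' = C(3)[OF near] \<open>0 < r\<close> \<open>r < 1\<close>
    \<comment> \<open>\<open>stationary_regime\<close> is an implication. Closeness of the estimate
      to \<open>\<theta>\<close> makes the weights summable, so the moving average is a stationary
      causal solution and discharges the premise.\<close>
    have "stationary_causal_solution ?N p ?\<theta> ?\<epsilon> ?X"
      using assms(13) n \<omega>M
        B.ma_process_stationary_causal_solution[OF summable_abs_of_geometric_bound[OF psi']]
      unfolding stationary_regime_def by blast
    then have X: "ar_solution ?N p ?\<theta> ?\<epsilon> ?X" "stationary ?N ?X"
      by (simp_all add: stationary_causal_solution_def)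
    let ?b = "C * r ^ nat (t 1 - s k) / (1 - r) * (3 * sqrt \<sigma>2)"
    have "ennreal \<bar>covariance ?N (\<lambda>\<omega>'. g (\<lambda>i\<in>{1..k}. ?X (s i) \<omega>')) (\<lambda>\<omega>'. h (\<lambda>i\<in>{1..l}. ?X (t i) \<omega>'))\<bar>
        \<le> sup_norm k g * Lip l h * ennreal (2 * real l * ?b)"
    proof (rule B.covariance_linear_process_le[OF psi' _ _ first_moment _ _ st g h bdd int_h])
      show "AE \<omega>' in ?N. ?X u \<omega>' = (\<Sum>j. ma_coeff p ?\<theta> j * ?\<epsilon> (u - int j) \<omega>')" for u
        by (rule B.stationary_ar_solution_eq_ma[OF X psi'])
      show "?X u \<in> borel_measurable ?N" for u
        using X(1) by (simp add: ar_solution_def)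
      show "s i \<le> s k" if "i \<in> {1..k}" for i
        using that kl by (intro mono_onD[OF s]) auto
      show "t 1 \<le> t i" if "i \<in> {1..l}" for i
        using that kl by (intro mono_onD[OF t]) auto
    qed
    also have "\<dots> \<le> sup_norm k g * Lip l h * ennreal (2 * K * sqrt \<sigma>2 * real l *
        ((1 + \<eta>) / \<rho>) powi (t 1 - s k))"
    proof (intro mult_left_mono ennreal_leI)
      \<comment> \<open>The ordering \<open>s k \<le> t 1\<close> makes the exponent nonnegative, so
        \<open>powi\<close> is an ordinary power and enlarging the base from \<open>r\<close> to
        \<open>(1 + \<eta>) / \<rho>\<close> only weakens the bound.\<close>
      have "r ^ nat (t 1 - s k) \<le> ((1 + \<eta>) / \<rho>) ^ nat (t 1 - s k)"
        using \<open>0 < r\<close> by (intro power_mono) (auto simp: r_def)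
      also have "\<dots> = ((1 + \<eta>) / \<rho>) powi (t 1 - s k)"
        using st by (simp add: power_int_def)
      finally have "2 * K * sqrt \<sigma>2 * real l * r ^ nat (t 1 - s k)
          \<le> 2 * K * sqrt \<sigma>2 * real l * ((1 + \<eta>) / \<rho>) powi (t 1 - s k)"
        using C(1) \<open>r < 1\<close> \<open>\<sigma>2 \<ge> 0\<close> by (intro mult_left_mono) (auto simp: K_def)
      then show "2 * real l * ?b \<le> 2 * K * sqrt \<sigma>2 * real l * ((1 + \<eta>) / \<rho>) powi (t 1 - s k)"
        by (simp add: K_def mult_ac)
    qed simp
    finally show "ennreal \<bar>covariance ?N (\<lambda>\<omega>'. g (\<lambda>i\<in>{1..k}. ?X (s i) \<omega>'))
          (\<lambda>\<omega>'. h (\<lambda>i\<in>{1..l}. ?X (t i) \<omega>'))\<bar>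
        \<le> sup_norm k g * Lip l h *
          ennreal (2 * K * sqrt (integral\<^sup>L M (\<lambda>\<omega>. (\<epsilon> 0 \<omega>)\<^sup>2)) * real l *
            ((1 + \<eta>) / min_root_modulus p \<theta>) powi (t 1 - s k))"
      unfolding \<sigma>2_def \<rho>_def .
  qed
qed

end
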